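(* Let $\mathcal G=(G=(V,E),\varrho,\Lambda,B)$ be a temporally connected dangerous network in the TRAN model with anonymous nodes, let $\eta'$ be the number of transient edges of $\mathcal G$ that are not dangerous, and consider a team of at least $2\eta'+\sum_{b\in B}\delta(b)+1$ oblivious and anonymous agents, initially arranged at the centers of arbitrary safe nodes, activated by any semi-synchronous (SSYNCH) scheduler, without any prior knowledge of $\mathcal G$, all executing the algorithm $\mathcal A^\infty$. Then the team solves Safe Perpetual Exploration: every safe node of $\mathcal G$ is visited infinitely often. Moreover, eventually $\mathcal A^\infty$ provides a highly reliable port marking on $\mathcal G$.
   Context: **Network.** A network is $\mathcal G=(G,\varrho,\Lambda,B)$, where $G=(V,E)$ is a finite simple undirected graph; $\varrho:E\times\mathbb N_0\to\{0,1\}$ says whether edge $e$ is present ($1$) or absent ($0$) at time $t$; $B\subsetneq V$ is the (possibly empty) set of black holes, the nodes of $V\setminus B$ being called safe. No edge joins two black holes. Each node $v$ of degree $\delta(v)$ has, for each incident edge $\{v,w\}\in E$, a port $p_{v,w}$ (there whether or not the edge is currently present); $\Lambda$ consists of bijections $\lambda_v$ from the ports of $v$ to $\{0,\dots,\delta(v)-1\}$, which are fixed, arbitrary and visible only at $v$. Each port has an ingoing and an outgoing sub-port. An edge is recurrent if for every $t$ it is present at some $t'>t$, and transient otherwise. A journey is a sequence $((e_1,t_1),\dots,(e_m,t_m))$ with $(e_1,\dots,e_m)$ a walk in $G$, $t_1<\dots<t_m$ and $\varrho(e_i,t_i)=1$ for all $i$. Networks are always assumed temporally connected: for all $v,w\in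 V$ and all $t$ there is a journey from $v$ to $w$ starting at a time $\ge t$ containing no black hole except possibly its endpoints $v,w$. The TRAN model consists of all such networks (transient edges allowed). An edge $\{v,w\}$ and its ports are safe if $v,w$ are both safe, and dangerous otherwise. **Agents.** Agents are anonymous and oblivious (no IDs, no personal memory). Each node $v$ has a whiteboard (persistent local memory, accessed in mutual exclusion). An agent sees only its own node: its position in the node (center or a sub-port), the port labels, the whiteboard, and how many agents are at the center and on each sub-port; it does not see whether incident edges are present. An agent entering a black hole is trapped there forever; otherwise it is free. Time proceeds in rounds $t=0,1,2,\dots$. In each round a subset of agents chosen by the scheduler is activated; one after another, in an order chosen by the scheduler, the activated agents perform a Compute step (read the whiteboard, compute, possibly rewrite the whiteboard, possibly move to the center or to an outgoing sub-port of the current node); then, simultaneously (Move step), each activated agent on the outgoing sub-port of $p_{v,w}$ with $\varrho(\{v,w\},t)=1$ crosses the edge and arrives at the ingoing sub-port of $p_{w,v}$ at $w$. SSYNCH: the activated subsets are arbitrary subject to fairness (every agent is activated infinitely often) and eventual transport (an agent on an outgoing sub-port of a recurrent edge is eventually activated at a time when that edge is present). A node is visited at time $t$ if some agent is in it (center or sub-port) at time $t$. **Algorithm $\mathcal A^\infty$.** The whiteboard of each safe node $v$ holds $\mathrm{rotor}_v\in\{0,\dots,\delta(v)-1\}$, initially $0$, and an array $\mathrm{ports}_v\in\{\text{SAFE},\text{UNEXPLORED},\text{DANGEROUS}\}^{\delta(v)}$ (the marks of the ports), initially all UNEXPLORED. A port of $v$ is a candidate if it is not marked DANGEROUS and no agent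 is on either of its sub-ports. Compute step of an agent $a$ in a safe node $v$: (1) If $a$ is at the center: let $j$ be the first candidate port in the cyclic order $\mathrm{rotor}_v,\mathrm{rotor}_v+1,\dots \pmod{\delta(v)}$. If there is none, $a$ does nothing. Otherwise $a$ moves to the outgoing sub-port of port $j$, sets $\mathrm{rotor}_v\leftarrow j+1 \bmod \delta(v)$, and if $\mathrm{ports}_v[j]$ is UNEXPLORED sets it to DANGEROUS. (2) If $a$ is on the ingoing sub-port of $p_{v,w}$: if the port is marked UNEXPLORED, $a$ marks it SAFE and moves to the outgoing sub-port of $p_{v,w}$; if marked DANGEROUS, $a$ marks it SAFE and moves to the center; if marked SAFE, $a$ moves to the center. (3) If $a$ is on an outgoing sub-port, it does nothing in the Compute step. **Highly reliable port marking.** It is achieved if at some finite time $t$: at least one agent is free; for every recurrent edge, its ports at safe nodes are correctly marked (SAFE if safe, DANGEROUS if dangerous); all dangerous ports at safe nodes are marked DANGEROUS; and these marks never change at times $t'\ge t$. *)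

theory Defs
  imports Main
begin

text \<open>
  The underlying graph is given by a vertex set and a set of two-element edges. The port of \<open>v\<close>
  towards its neighbour \<open>w\<close> is identified with the pair \<open>(v, w)\<close>, and \<open>label N v w\<close> is the number
  it carries at \<open>v\<close>.
\<close>

record 'v network =
  nodes :: "'v set"
  edges :: "'v set set"
  present :: "'v set \<Rightarrow> nat \<Rightarrow> bool"
  label :: "'v \<Rightarrow> 'v \<Rightarrow> nat"
  holes :: "'v set"

definition safe_nodes :: "'v network \<Rightarrow> 'v set" where
  "safe_nodes N = nodes N - holes N"

definition neighbours :: "'v network \<Rightarrow> 'v \<Rightarrow> 'v set" where
  "neighbours N v = {w. {v, w} \<in> edges N}"

definition degree :: "'v network \<Rightarrow> 'v \<Rightarrow> nat" where
  "degree N v = card (neighbours N v)"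

definition network :: "'v network \<Rightarrow> bool" where
  "network N \<longleftrightarrow>
     finite (nodes N) \<and>
     (\<forall>e\<in>edges N. e \<subseteq> nodes N \<and> card e = 2) \<and>
     holes N \<subset> nodes N \<and>
     (\<forall>e\<in>edges N. \<not> e \<subseteq> holes N) \<and>
     (\<forall>v\<in>nodes N. bij_betw (label N v) (neighbours N v) {..<degree N v})"

definition recurrent :: "'v network \<Rightarrow> 'v set \<Rightarrow> bool" where
  "recurrent N e \<longleftrightarrow> (\<forall>t. \<exists>t'>t. present N e t')"

definition transient :: "'v network \<Rightarrow> 'v set \<Rightarrow> bool" where
  "transient N e \<longleftrightarrow> \<not> recurrent N e"

definition safe_edge :: "'v network \<Rightarrow> 'v set \<Rightarrow> bool" where
  "safe_edge N e \<longleftrightarrow> e \<subseteq> safe_nodes N"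

definition dangerous_edge :: "'v network \<Rightarrow> 'v set \<Rightarrow> bool" where
  "dangerous_edge N e \<longleftrightarrow> \<not> safe_edge N e"

text \<open>
  \<open>walk N vs es\<close>: the edge sequence \<open>es\<close> is a walk through the node sequence \<open>vs\<close>.
  The empty edge sequence is a walk from a node to itself.
\<close>

definition walk :: "'v network \<Rightarrow> 'v list \<Rightarrow> 'v set list \<Rightarrow> bool" where
  "walk N vs es \<longleftrightarrow>
     length vs = Suc (length es) \<and> set vs \<subseteq> nodes N \<and>
     (\<forall>i<length es. es ! i \<in> edges N \<and> es ! i = {vs ! i, vs ! Suc i})"

definition journey :: "'v network \<Rightarrow> 'v list \<Rightarrow> ('v set \<times> nat) list \<Rightarrow> bool" where
  "journey N vs J \<longleftrightarrow>
     walk N vs (map fst J) \<and> sorted_wrt (<) (map snd J) \<and> (\<forall>(e, t)\<in>set J. present N e t)"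

definition temporally_connected :: "'v network \<Rightarrow> bool" where
  "temporally_connected N \<longleftrightarrow>
     (\<forall>v\<in>nodes N. \<forall>w\<in>nodes N. \<forall>t. \<exists>vs J.
        journey N vs J \<and> hd vs = v \<and> last vs = w \<and>
        (\<forall>(e, s)\<in>set J. t \<le> s) \<and> set vs \<inter> holes N \<subseteq> {v, w})"

definition tran_network :: "'v network \<Rightarrow> bool" where
  "tran_network N \<longleftrightarrow> network N \<and> temporally_connected N"

datatype mark = Safe | Unexplored | Dangerous

record whiteboard =
  rotor :: nat
  ports :: "nat \<Rightarrow> mark"

text \<open>The sub-ports of a node are referred to by the label of the port.\<close>

datatype place = Center | Ingoing nat | Outgoing nat

text \<open>
  The Compute step of the algorithm depends only on what an agent sees locally: the degree \<open>d\<close> of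
  the node, the number \<open>crowd q\<close> of agents at each place \<open>q\<close> of the node, the agent's own place,
  and the whiteboard. It returns the new place within the node and the new whiteboard.
\<close>

definition candidate :: "(place \<Rightarrow> nat) \<Rightarrow> whiteboard \<Rightarrow> nat \<Rightarrow> bool" where
  "candidate crowd wb j \<longleftrightarrow>
     ports wb j \<noteq> Dangerous \<and> crowd (Ingoing j) = 0 \<and> crowd (Outgoing j) = 0"

definition first_candidate :: "nat \<Rightarrow> (place \<Rightarrow> nat) \<Rightarrow> whiteboard \<Rightarrow> nat option" where
  "first_candidate d crowd wb =
     find (candidate crowd wb) (map (\<lambda>k. (rotor wb + k) mod d) [0..<d])"

fun A_infty :: "nat \<Rightarrow> (place \<Rightarrow> nat) \<Rightarrow> place \<Rightarrow> whiteboard \<Rightarrow> place \<times> whiteboard" where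
  "A_infty d crowd Center wb =
     (case first_candidate d crowd wb of
        None \<Rightarrow> (Center, wb)
      | Some j \<Rightarrow>
          (Outgoing j,
           \<lparr>rotor = (j + 1) mod d,
            ports = (if ports wb j = Unexplored then (ports wb)(j := Dangerous) else ports wb)\<rparr>))"
| "A_infty d crowd (Ingoing j) wb =
     (case ports wb j of
        Unexplored \<Rightarrow> (Outgoing j, wb\<lparr>ports := (ports wb)(j := Safe)\<rparr>)
      | Dangerous \<Rightarrow> (Center, wb\<lparr>ports := (ports wb)(j := Safe)\<rparr>)
      | Safe \<Rightarrow> (Center, wb))"
| "A_infty d crowd (Outgoing j) wb = (Outgoing j, wb)"

text \<open>
  A configuration gives the node and place of every agent and the whiteboard of every node. Agent
  names only serve to describe executions. The team is a set \<open>A\<close> of names; the components of a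
  configuration outside \<open>A\<close>, and the whiteboards of black holes, play no role.
\<close>

record ('v, 'a) config =
  pos :: "'a \<Rightarrow> 'v \<times> place"
  board :: "'v \<Rightarrow> whiteboard"

definition crowd_at :: "'a set \<Rightarrow> ('v, 'a) config \<Rightarrow> 'v \<Rightarrow> place \<Rightarrow> nat" where
  "crowd_at A C v q = card {a \<in> A. pos C a = (v, q)}"

definition compute_step :: "'v network \<Rightarrow> 'a set \<Rightarrow> 'a \<Rightarrow> ('v, 'a) config \<Rightarrow> ('v, 'a) config" where
  "compute_step N A a C =
     (let (v, q) = pos C a in
      if v \<in> holes N then C
      else let (q', wb') = A_infty (degree N v) (crowd_at A C v) q (board C v)
           in C\<lparr>pos := (pos C)(a := (v, q')), board := (board C)(v := wb')\<rparr>)"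

definition far_end :: "'v network \<Rightarrow> 'v \<Rightarrow> nat \<Rightarrow> 'v" where
  "far_end N v j = (THE w. w \<in> neighbours N v \<and> label N v w = j)"

fun cross :: "'v network \<Rightarrow> nat \<Rightarrow> 'v \<times> place \<Rightarrow> 'v \<times> place" where
  "cross N t (v, Outgoing j) =
     (let w = far_end N v j in
      if present N {v, w} t then (w, Ingoing (label N w v)) else (v, Outgoing j))"
| "cross N t (v, q) = (v, q)"

definition move_step :: "'v network \<Rightarrow> nat \<Rightarrow> 'a set \<Rightarrow> ('v, 'a) config \<Rightarrow> ('v, 'a) config" where
  "move_step N t S C = C\<lparr>pos := (\<lambda>a. if a \<in> S then cross N t (pos C a) else pos C a)\<rparr>"

text \<open>
  The scheduler is a function \<open>act\<close>: the list \<open>act t\<close> contains the agents activated in round \<open>t\<close>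
  in the order in which they perform their Compute steps. \<open>execution N A start act t\<close> is the
  configuration at the beginning of round \<open>t\<close>, where \<open>start\<close> gives the initial nodes of the agents.
\<close>

primrec execution ::
    "'v network \<Rightarrow> 'a set \<Rightarrow> ('a \<Rightarrow> 'v) \<Rightarrow> (nat \<Rightarrow> 'a list) \<Rightarrow> nat \<Rightarrow> ('v, 'a) config" where
  "execution N A start act 0 =
     \<lparr>pos = (\<lambda>a. (start a, Center)), board = (\<lambda>v. \<lparr>rotor = 0, ports = (\<lambda>j. Unexplored)\<rparr>)\<rparr>"
| "execution N A start act (Suc t) =
     move_step N t (set (act t)) (fold (compute_step N A) (act t) (execution N A start act t))"

definition fair :: "'a set \<Rightarrow> (nat \<Rightarrow> 'a list) \<Rightarrow> bool" where
  "fair A act \<longleftrightarrow> (\<forall>a\<in>A. \<forall>t. \<exists>t'\<ge>t. a \<in> set (act t'))"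

definition eventual_transport ::
    "'v network \<Rightarrow> 'a set \<Rightarrow> (nat \<Rightarrow> 'a list) \<Rightarrow> (nat \<Rightarrow> ('v, 'a) config) \<Rightarrow> bool" where
  "eventual_transport N A act X \<longleftrightarrow>
     (\<forall>t. \<forall>a\<in>A. \<forall>v w.
        {v, w} \<in> edges N \<and> recurrent N {v, w} \<and> pos (X t) a = (v, Outgoing (label N v w)) \<longrightarrow>
        (\<exists>t'\<ge>t. a \<in> set (act t') \<and> present N {v, w} t'))"

definition ssynch ::
    "'v network \<Rightarrow> 'a set \<Rightarrow> (nat \<Rightarrow> 'a list) \<Rightarrow> (nat \<Rightarrow> ('v, 'a) config) \<Rightarrow> bool" where
  "ssynch N A act X \<longleftrightarrow>
     (\<forall>t. distinct (act t) \<and> set (act t) \<subseteq> A) \<and> fair A act \<and> eventual_transport N A act X"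

definition visited :: "'a set \<Rightarrow> ('v, 'a) config \<Rightarrow> 'v \<Rightarrow> bool" where
  "visited A C v \<longleftrightarrow> (\<exists>a\<in>A. fst (pos C a) = v)"

definition safe_perpetual_exploration ::
    "'v network \<Rightarrow> 'a set \<Rightarrow> (nat \<Rightarrow> ('v, 'a) config) \<Rightarrow> bool" where
  "safe_perpetual_exploration N A X \<longleftrightarrow>
     (\<forall>v\<in>safe_nodes N. \<forall>t. \<exists>t'\<ge>t. visited A (X t') v)"

definition free :: "'v network \<Rightarrow> ('v, 'a) config \<Rightarrow> 'a \<Rightarrow> bool" where
  "free N C a \<longleftrightarrow> fst (pos C a) \<notin> holes N"

definition port_mark :: "'v network \<Rightarrow> ('v, 'a) config \<Rightarrow> 'v \<Rightarrow> 'v \<Rightarrow> mark" where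
  "port_mark N C v w = ports (board C v) (label N v w)"

definition highly_reliable_port_marking ::
    "'v network \<Rightarrow> 'a set \<Rightarrow> (nat \<Rightarrow> ('v, 'a) config) \<Rightarrow> bool" where
  "highly_reliable_port_marking N A X \<longleftrightarrow>
     (\<exists>t.
        (\<exists>a\<in>A. free N (X t) a) \<and>
        (\<forall>v\<in>safe_nodes N. \<forall>w\<in>neighbours N v. recurrent N {v, w} \<longrightarrow>
           port_mark N (X t) v w = (if safe_edge N {v, w} then Safe else Dangerous)) \<and>
        (\<forall>v\<in>safe_nodes N. \<forall>w\<in>neighbours N v. dangerous_edge N {v, w} \<longrightarrow>
           port_mark N (X t) v w = Dangerous) \<and>
        (\<forall>t'\<ge>t. \<forall>v\<in>safe_nodes N. \<forall>w\<in>neighbours N v.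
           recurrent N {v, w} \<or> dangerous_edge N {v, w} \<longrightarrow>
           port_mark N (X t') v w = port_mark N (X t) v w))"

end

theory Submission
  imports Defs Complex_Main
begin

text \<open>
  Count, for a pair \<open>(v, w)\<close> of adjacent nodes, the agents on their way from \<open>v\<close> to \<open>w\<close>: those on the
  outgoing sub-port of \<open>v\<close> and those on the ingoing sub-port of \<open>w\<close>. An invariant links this flow to
  the two marks of the edge. It shows that an outgoing sub-port never holds two agents, that an
  edge to a black hole swallows at most one agent, and that a DANGEROUS mark on a safe
  edge is always witnessed by an agent that is still going to remove it.

  Marks only progress, so each port has a final mark. Call a node engaged if agents at its center are
  activated infinitely often. If no node were engaged, all agents would end up in black holes, or
  on outgoing sub-ports of dangerous or of safe transient edges, and by the invariant there is room
  for only \<open>2\<eta>' + (\<Sum>b\<in>B. \<delta>(b))\<close> of them. At an engaged node the rotor reaches every port, so each port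
  is used, blocked by agents, or DANGEROUS again and again; on a recurrent safe edge this makes the other
  endpoint engaged too. Safe nodes are connected by recurrent safe edges, so all of them are engaged,
  which yields both the exploration and the final marks.
\<close>

section \<open>Cyclic search for a candidate port and the rotor distance\<close>

lemma first_candidate_Some:
  assumes "first_candidate d cr wb = Some c"
  shows "\<exists>k<d. c = (rotor wb + k) mod d \<and> candidate cr wb c \<and>
    (\<forall>l<k. \<not> candidate cr wb ((rotor wb + l) mod d))"
  using assms unfolding first_candidate_def find_Some_iff by auto

text \<open>The number of cyclic steps from \<open>r\<close> to \<open>j\<close>. It is the descent
  measure for a rotor that keeps choosing other ports while \<open>j\<close> is a candidate.\<close>

definition rotor_dist :: "nat \<Rightarrow> nat \<Rightarrow> nat \<Rightarrow> nat" where
  "rotor_dist d j r = (LEAST k. (r + k) mod d = j)"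

lemma rotor_dist_eq:
  assumes "j < d"
  shows "(r + rotor_dist d j r) mod d = j"
proof -
  \<comment> \<open>The offset \<open>j + (d - 1) * r\<close> avoids subtracting \<open>r\<close> in
    the natural numbers: together with \<open>r\<close> it is \<open>j\<close> plus a multiple of
    \<open>d\<close>. It only shows that the \<open>LEAST\<close> is attained.\<close>
  have "(r + (j + (d - 1) * r)) mod d = (d * r + j) mod d"
    using assms by (cases d) (simp_all add: algebra_simps)
  also have "\<dots> = j" using assms by simp
  finally show ?thesis unfolding rotor_dist_def by (rule LeastI)
qed

text \<open>The search stops at the smallest offset \<open>k\<close> of a candidate. Port
  \<open>j\<close> is itself a candidate at offset \<open>?D\<close> and \<open>c\<close> is not
  \<open>j\<close>, so \<open>k < ?D\<close>; the new rotor stands at offset \<open>k + 1\<close>,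
  which leaves at most \<open>?D - k - 1\<close> steps.\<close>

lemma rotor_dist_decreases:
  assumes "j < d" "candidate cr wb j" "first_candidate d cr wb = Some c" "c \<noteq> j"
  shows "rotor_dist d j ((c + 1) mod d) < rotor_dist d j (rotor wb)"
proof -
  let ?r = "rotor wb" and ?D = "rotor_dist d j (rotor wb)"
  obtain k where k: "c = (?r + k) mod d"
    "\<And>l. l < k \<Longrightarrow> \<not> candidate cr wb ((?r + l) mod d)"
    using first_candidate_Some[OF assms(3)] by metis
  have D: "(?r + ?D) mod d = j" using assms(1) by (rule rotor_dist_eq)
  have "\<not> ?D < k" using k(2) D assms(2) by metis
  moreover have "?D \<noteq> k" using k(1) D assms(4) by metis
  ultimately have "k < ?D" by simp
  have "((c + 1) mod d + (?D - k - 1)) mod d = (?r + k + 1 + (?D - k - 1)) mod d"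
    unfolding k(1) by (simp add: mod_simps)
  also have "?r + k + 1 + (?D - k - 1) = ?r + ?D" using \<open>k < ?D\<close> by simp
  finally have "((c + 1) mod d + (?D - k - 1)) mod d = j" using D by simp
  then have "rotor_dist d j ((c + 1) mod d) \<le> ?D - k - 1"
    unfolding rotor_dist_def by (rule Least_le)
  then show ?thesis using \<open>k < ?D\<close> by simp
qed

lemma first_candidate_None:
  assumes "first_candidate d cr wb = None" "j < d"
  shows "\<not> candidate cr wb j"
proof -
  obtain l where l: "(rotor wb + l) mod d = j" using rotor_dist_eq[OF assms(2)] by blast
  \<comment> \<open>The offset is reduced because the search inspects only offsets below
    \<open>d\<close>.\<close>
  then have "(rotor wb + l mod d) mod d = j" by (simp add: mod_simps)
  moreover have "l mod d < d" using assms(2) by simp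
  ultimately show ?thesis
    using assms(1) unfolding first_candidate_def find_None_iff by auto
qed

lemma eventually_constant_if_nonincreasing:
  fixes g :: "nat \<Rightarrow> nat"
  assumes "\<And>t. t \<ge> T \<Longrightarrow> g (Suc t) \<le> g t"
  shows "\<exists>T'\<ge>T. \<forall>t\<ge>T'. g t = g T'"
proof -
  obtain T' where T': "T' \<ge> T" "\<And>t. t \<ge> T \<Longrightarrow> g T' \<le> g t"
    using ex_has_least_nat[of "\<lambda>t. t \<ge> T" T g] by auto
  have "g t \<le> g T'" if "t \<ge> T'" for t
    using that
  proof (induction rule: dec_induct)
    case (step n) then show ?case using assms[of n] T'(1) by linarith
  qed simp
  then show ?thesis using T' by (meson le_antisym order_trans)
qed

section \<open>Effect of a single Compute step\<close>

lemma crowd_at_pos_iff: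
  assumes "finite A"
  shows "0 < crowd_at A C v q \<longleftrightarrow> (\<exists>a\<in>A. pos C a = (v, q))"
  using assms by (auto simp: crowd_at_def card_gt_0_iff)

text \<open>The board \<open>B\<close> is arbitrary so that one rule serves both Compute steps and
  crossings. The new place has to differ from the old one, since otherwise its counter would not
  grow.\<close>

lemma crowd_at_relocate:
  assumes "finite A" "a \<in> A" "p \<noteq> pos C a"
  shows "crowd_at A (C\<lparr>pos := (pos C)(a := p), board := B\<rparr>) y r =
    (if (y, r) = p then Suc (crowd_at A C y r)
     else if (y, r) = pos C a then crowd_at A C y r - 1 else crowd_at A C y r)"
proof -
  let ?S = "{b \<in> A. pos C b = (y, r)}"
  let ?S' = "{b \<in> A. ((pos C)(a := p)) b = (y, r)}"
  consider "(y, r) = p" | "(y, r) \<noteq> p" "(y, r) = pos C a" | "(y, r) \<noteq> p" "(y, r) \<noteq> pos C a"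
    by blast
  then have "card ?S' = (if (y, r) = p then Suc (card ?S)
     else if (y, r) = pos C a then card ?S - 1 else card ?S)"
  proof cases
    case 1
    then have "?S' = insert a ?S" "a \<notin> ?S" using assms by auto
    then show ?thesis using 1 assms(1) by simp
  next
    case 2
    then have "?S' = ?S - {a}" "a \<in> ?S" using assms by auto
    then show ?thesis using 2 assms(1) by simp
  next
    case 3
    then have "?S' = ?S" by auto
    then show ?thesis using 3 by simp
  qed
  then show ?thesis by (simp add: crowd_at_def)
qed

lemma A_infty_not_ingoing: "fst (A_infty d cr q wb) = Ingoing j \<Longrightarrow> False"
  by (cases q) (auto split: option.splits mark.splits)

lemma compute_step_hole: "pos C a = (v, q) \<Longrightarrow> v \<in> holes N \<Longrightarrow> compute_step N A a C = C"
  by (simp add: compute_step_def)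

lemma compute_step_pos:
  assumes "pos C a = (v, q)" "v \<notin> holes N"
  shows "pos (compute_step N A a C) a =
    (v, fst (A_infty (degree N v) (crowd_at A C v) q (board C v)))"
  using assms by (simp add: compute_step_def split: prod.split)

lemma compute_step_board:
  assumes "pos C a = (v, q)" "v \<notin> holes N"
  shows "board (compute_step N A a C) v =
    snd (A_infty (degree N v) (crowd_at A C v) q (board C v))"
  using assms by (simp add: compute_step_def split: prod.split)

lemma compute_step_pos_other: "b \<noteq> a \<Longrightarrow> pos (compute_step N A a C) b = pos C b"
  by (simp add: compute_step_def split: prod.split)

lemma compute_step_board_other:
  "fst (pos C a) \<noteq> v \<Longrightarrow> board (compute_step N A a C) v = board C v"
  by (cases "pos C a") (simp add: compute_step_def split: prod.split)

text \<open>Marks progress only in the order UNEXPLORED, DANGEROUS, SAFE, possibly skipping the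
  middle. Counting the remaining stages gives a natural number that never increases, so every mark
  settles.\<close>

fun mark_deficit :: "mark \<Rightarrow> nat" where
  "mark_deficit Unexplored = 2"
| "mark_deficit Dangerous = 1"
| "mark_deficit Safe = 0"

lemma mark_deficit_inject: "mark_deficit m = mark_deficit m' \<longleftrightarrow> m = m'"
  by (cases m; cases m') auto

lemma compute_step_mark_deficit:
  "mark_deficit (ports (board (compute_step N A a C) v) j) \<le> mark_deficit (ports (board C v) j)"
proof -
  obtain u q where u: "pos C a = (u, q)" by fastforce
  show ?thesis
    using u by (cases q) (auto simp: compute_step_def split: prod.splits option.splits mark.splits)
qed

lemma frequently_sequentially_later:
  assumes "\<exists>\<^sub>F t in sequentially. P t" "\<And>t. P t \<Longrightarrow> \<exists>t'\<ge>t. Q t'"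
  shows "\<exists>\<^sub>F t in sequentially. Q t"
  using assms unfolding frequently_sequentially by (meson order_trans)

lemma not_eventually_strictly_decreasing:
  fixes g :: "nat \<Rightarrow> nat"
  assumes "\<forall>\<^sub>F t in sequentially. g (Suc t) \<le> g t" "\<exists>\<^sub>F t in sequentially. g (Suc t) < g t"
  shows False
proof -
  obtain T where "\<And>t. t \<ge> T \<Longrightarrow> g (Suc t) \<le> g t"
    using assms(1) unfolding eventually_sequentially by blast
  then obtain T' where T': "\<And>t. t \<ge> T' \<Longrightarrow> g t = g T'"
    using eventually_constant_if_nonincreasing by metis
  obtain t where "t \<ge> T'" "g (Suc t) < g t"
    using assms(2) unfolding frequently_sequentially by blast
  then show False using T'[of t] T'[of "Suc t"] by simp
qed

subsection \<open>Executions\<close>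

locale run =
  fixes N :: "'v network" and A :: "'a set" and start :: "'a \<Rightarrow> 'v" and act :: "nat \<Rightarrow> 'a list"
  assumes tran: "tran_network N"
    and fin: "finite A"
    and start: "\<forall>a\<in>A. start a \<in> safe_nodes N"
    and sched: "ssynch N A act (execution N A start act)"
begin

abbreviation X where "X \<equiv> execution N A start act"
abbreviation out where "out v w \<equiv> (v, Outgoing (label N v w))"
abbreviation ing where "ing v w \<equiv> (v, Ingoing (label N v w))"

text \<open>Agents of one round compute one after another, so what an agent sees is such an
  intermediate configuration: \<open>i\<close> Compute steps of round \<open>t\<close> are done and
  no crossing has taken place yet.\<close>

definition micro :: "nat \<Rightarrow> nat \<Rightarrow> ('v, 'a) config" where
  "micro t i = fold (compute_step N A) (take i (act t)) (X t)"

lemma net: "network N" using tran by (simp add: tran_network_def)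

lemma edge_nodes: "{v, w} \<in> edges N \<Longrightarrow> v \<in> nodes N \<and> w \<in> nodes N \<and> v \<noteq> w"
  using net unfolding network_def by fastforce

lemma finite_safe: "finite (safe_nodes N)"
  using net by (auto simp: network_def safe_nodes_def)

lemma finite_edges: "finite (edges N)"
proof (rule finite_subset)
  show "edges N \<subseteq> Pow (nodes N)" "finite (Pow (nodes N))" using net by (auto simp: network_def)
qed

lemma finite_neighbours: "finite (neighbours N v)"
proof (rule finite_subset)
  show "neighbours N v \<subseteq> nodes N" "finite (nodes N)"
    using net edge_nodes by (auto simp: network_def neighbours_def)
qed

lemma label_inject:
  assumes "{v, w} \<in> edges N" "{v, w'} \<in> edges N"
  shows "label N v w = label N v w' \<longleftrightarrow> w = w'"
proof -
  have "bij_betw (label N v) (neighbours N v) {..<degree N v}"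
    using net edge_nodes[OF assms(1)] by (simp add: network_def)
  then show ?thesis using assms
    by (auto simp: bij_betw_def inj_on_def neighbours_def)
qed

lemma port_eq_iff:
  assumes "{v, w} \<in> edges N" "{v', w'} \<in> edges N"
  shows "v = v' \<and> label N v w = label N v' w' \<longleftrightarrow> v = v' \<and> w = w'"
  using assms label_inject by auto

lemma label_less: "{v, w} \<in> edges N \<Longrightarrow> label N v w < degree N v"
  using net edge_nodes[of v w] by (fastforce simp: network_def bij_betw_def neighbours_def)

lemma label_cases:
  assumes "v \<in> nodes N" "j < degree N v"
  obtains w where "{v, w} \<in> edges N" "j = label N v w"
proof -
  have "bij_betw (label N v) (neighbours N v) {..<degree N v}"
    using net assms by (simp add: network_def)
  then have "j \<in> label N v ` neighbours N v" using assms by (simp add: bij_betw_def)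
  then show ?thesis using that by (auto simp: neighbours_def)
qed

lemma far_end_label: "{v, w} \<in> edges N \<Longrightarrow> far_end N v (label N v w) = w"
  unfolding far_end_def by (rule the_equality) (auto simp: neighbours_def label_inject)

lemma act_set: "set (act t) \<subseteq> A" and act_distinct: "distinct (act t)"
  using sched by (auto simp: ssynch_def)

lemma fairness: "a \<in> A \<Longrightarrow> \<exists>t'\<ge>t. a \<in> set (act t')"
  using sched by (auto simp: ssynch_def fair_def)

subsection \<open>The flow invariant\<close>

text \<open>An agent in a black hole stays on the ingoing sub-port where it arrived, so only centers
  of safe nodes occur. Outgoing sub-ports of black holes are ruled out later, by
  \<open>wf_out_not_hole\<close>.\<close>

definition placed :: "('v, 'a) config \<Rightarrow> 'a \<Rightarrow> bool" where
  "placed C a \<longleftrightarrow> (\<exists>v\<in>safe_nodes N. pos C a = (v, Center)) \<or>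
     (\<exists>v w. {v, w} \<in> edges N \<and> (pos C a = ing v w \<or> pos C a = out v w))"

definition flow :: "('v, 'a) config \<Rightarrow> 'v \<Rightarrow> 'v \<Rightarrow> nat" where
  "flow C v w = crowd_at A C v (Outgoing (label N v w)) + crowd_at A C w (Ingoing (label N w v))"

text \<open>
  If both ports are marked DANGEROUS, one agent travels in each direction; once the port of \<open>w\<close> is SAFE,
  the agent that will clear the mark of \<open>v\<close> is one coming from \<open>w\<close>.
\<close>

definition edge_inv :: "('v, 'a) config \<Rightarrow> 'v \<Rightarrow> 'v \<Rightarrow> bool" where
  "edge_inv C v w \<longleftrightarrow>
     crowd_at A C v (Outgoing (label N v w)) \<le> 1 \<and>
     (port_mark N C v w = Unexplored \<longrightarrow> flow C v w = 0 \<and> port_mark N C w v \<noteq> Safe) \<and>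
     (port_mark N C v w = Dangerous \<and> port_mark N C w v \<noteq> Safe \<longrightarrow> flow C v w = 1) \<and>
     (port_mark N C v w = Dangerous \<and> port_mark N C w v = Safe \<longrightarrow> flow C w v \<ge> 1)"

text \<open>Black holes enter \<open>edge_inv\<close> as nodes whose marks stay UNEXPLORED. This
  forces the flow out of them to be zero and keeps the ports leading to them from being marked
  SAFE.\<close>

definition wf_config :: "('v, 'a) config \<Rightarrow> bool" where
  "wf_config C \<longleftrightarrow> (\<forall>a\<in>A. placed C a) \<and> (\<forall>b\<in>holes N. \<forall>j. ports (board C b) j = Unexplored) \<and>
     (\<forall>v w. {v, w} \<in> edges N \<longrightarrow> edge_inv C v w)"

lemma wf_placed: "wf_config C \<Longrightarrow> a \<in> A \<Longrightarrow> placed C a"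
  and wf_hole: "wf_config C \<Longrightarrow> b \<in> holes N \<Longrightarrow> ports (board C b) j = Unexplored"
  and wf_edge: "wf_config C \<Longrightarrow> {v, w} \<in> edges N \<Longrightarrow> edge_inv C v w"
  by (simp_all add: wf_config_def)

lemma wf_out_not_hole:
  assumes "wf_config C" "{v, w} \<in> edges N" "a \<in> A" "pos C a = out v w"
  shows "v \<notin> holes N"
proof
  assume "v \<in> holes N"
  then have "flow C v w = 0"
    using wf_edge[OF assms(1,2)] wf_hole[OF assms(1)] by (simp add: edge_inv_def port_mark_def)
  moreover have "0 < crowd_at A C v (Outgoing (label N v w))"
    unfolding crowd_at_pos_iff[OF fin] using assms(3,4) by blast
  ultimately show False by (simp add: flow_def)
qed

text \<open>A crossing takes an agent from one summand of \<open>flow C v w\<close> to the other, so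
  all flows and marks are unchanged, and the crowds on outgoing sub-ports can only shrink.\<close>

lemma wf_cross:
  assumes I: "wf_config C" and a: "a \<in> A"
  shows "wf_config (move_step N t {a} C)"
proof -
  let ?C' = "move_step N t {a} C"
  show ?thesis
  proof (cases "cross N t (pos C a) = pos C a")
    case True
    then have "pos ?C' = pos C" by (auto simp: move_step_def)
    then have "?C' = C" by (simp add: move_step_def)
    then show ?thesis using I by simp
  next
    case False
    have "placed C a" using I a by (rule wf_placed)
    then obtain v w where vw: "{v, w} \<in> edges N" "pos C a = out v w"
      using False unfolding placed_def by auto
    have cr: "cross N t (pos C a) = ing w v"
      using False vw far_end_label[OF vw(1)] by (auto simp: Let_def split: if_splits)
    have wv: "{w, v} \<in> edges N" using vw(1) by (simp add: insert_commute)
    \<comment> \<open>The update \<open>board := board C\<close> changes nothing; it gives the term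
      the shape of \<open>crowd_at_relocate\<close>.\<close>
    have C': "?C' = C\<lparr>pos := (pos C)(a := ing w v), board := board C\<rparr>"
    proof -
      have "(\<lambda>b. if b \<in> {a} then cross N t (pos C b) else pos C b) = (pos C)(a := ing w v)"
        using cr by auto
      then show ?thesis by (simp add: move_step_def)
    qed
    have ne: "ing w v \<noteq> pos C a" using vw by simp
    have pos1: "0 < crowd_at A C v (Outgoing (label N v w))"
      unfolding crowd_at_pos_iff[OF fin] using a vw(2) by blast
    have o: "crowd_at A ?C' x (Outgoing (label N x y)) \<le> crowd_at A C x (Outgoing (label N x y))"
      for x y
      unfolding C' crowd_at_relocate[OF fin a ne] by simp
    have f: "flow ?C' x y = flow C x y" if xy: "{x, y} \<in> edges N" for x y
    proof -
      have yx: "{y, x} \<in> edges N" using xy by (simp add: insert_commute)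
      show ?thesis
        unfolding flow_def C' crowd_at_relocate[OF fin a ne] vw(2)
        using pos1 port_eq_iff[OF xy vw(1)] port_eq_iff[OF yx wv]
        by (cases "x = v \<and> y = w") auto
    qed
    have m: "port_mark N ?C' = port_mark N C" by (intro ext) (simp add: C' port_mark_def)
    have "edge_inv ?C' x y" if xy: "{x, y} \<in> edges N" for x y
    proof -
      have yx: "{y, x} \<in> edges N" using xy by (simp add: insert_commute)
      have "edge_inv C x y" using I xy by (rule wf_edge)
      then show ?thesis
        unfolding edge_inv_def f[OF xy] f[OF yx] m using o[of x y] by linarith
    qed
    moreover have "placed ?C' b" if "b \<in> A" for b
    proof (cases "b = a")
      case True
      then show ?thesis using wv by (auto simp: placed_def C')
    next
      case False
      moreover have "placed C b" using I that by (rule wf_placed)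
      ultimately show ?thesis by (simp add: placed_def C')
    qed
    moreover have "ports (board ?C' b) j = Unexplored" if "b \<in> holes N" for b j
      using wf_hole[OF I that] by (simp add: C')
    ultimately show ?thesis unfolding wf_config_def by blast
  qed
qed

text \<open>The target of a crossing depends only on the agent's own place and the round, so the
  simultaneous move can be carried out agent by agent.\<close>

lemma wf_move_step:
  assumes "wf_config C" "S \<subseteq> A"
  shows "wf_config (move_step N t S C)"
proof -
  have "finite S" using assms fin finite_subset by blast
  then show ?thesis using assms(2)
  proof (induction)
    case empty
    have "move_step N t {} C = C" by (simp add: move_step_def)
    then show ?case using assms by simp
  next
    case (insert a S)
    have "move_step N t (insert a S) C = move_step N t {a} (move_step N t S C)"
      using insert.hyps by (simp add: move_step_def fun_eq_iff)
    then show ?case using insert wf_cross by simp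
  qed
qed

text \<open>A Compute step at \<open>v\<close> affects only the center and the sub-ports and mark of
  a single edge. The invariant of every other edge carries over, which leaves the two orientations
  of this edge as obligations.\<close>

lemma wf_relocate:
  assumes wf: "wf_config C" and a: "a \<in> A" and vw: "{v, w} \<in> edges N" and safe: "v \<in> safe_nodes N"
    and p: "pos C a = (v, Center) \<and> p' = out v w \<or> pos C a = ing v w \<and> p' \<in> {(v, Center), out v w}"
    and C': "C' = C\<lparr>pos := (pos C)(a := p'), board := (board C)(v := wb)\<rparr>"
    and wb: "\<And>j. j \<noteq> label N v w \<Longrightarrow> ports wb j = ports (board C v) j"
    and ok: "edge_inv C' v w" "edge_inv C' w v"
  shows "wf_config C'"
proof -
  have ne: "p' \<noteq> pos C a" using p by auto
  have wv: "{w, v} \<in> edges N" using vw by (simp add: insert_commute)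
  have "placed C' b" if "b \<in> A" for b
  proof (cases "b = a")
    case True
    then show ?thesis using p vw safe by (auto simp: placed_def C')
  next
    case False
    moreover have "placed C b" using wf that by (rule wf_placed)
    ultimately show ?thesis by (simp add: placed_def C')
  qed
  moreover have "ports (board C' b) j = Unexplored" if "b \<in> holes N" for b j
    using wf_hole[OF wf that] that safe by (auto simp: C' safe_nodes_def)
  moreover have "edge_inv C' x y" if xy: "{x, y} \<in> edges N" for x y
  proof (cases "x = v \<and> y = w \<or> x = w \<and> y = v")
    case True
    then show ?thesis using ok by auto
  next
    case False
    have yx: "{y, x} \<in> edges N" using xy by (simp add: insert_commute)
    have 1: "x = v \<Longrightarrow> label N x y \<noteq> label N v w" "y = v \<Longrightarrow> label N y x \<noteq> label N v w"
      using False label_inject[OF xy] label_inject[OF yx] vw by auto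
    have c: "crowd_at A C' x (Outgoing (label N x y)) = crowd_at A C x (Outgoing (label N x y))"
      "crowd_at A C' y (Ingoing (label N y x)) = crowd_at A C y (Ingoing (label N y x))"
      "crowd_at A C' y (Outgoing (label N y x)) = crowd_at A C y (Outgoing (label N y x))"
      "crowd_at A C' x (Ingoing (label N x y)) = crowd_at A C x (Ingoing (label N x y))"
      unfolding C' crowd_at_relocate[OF fin a ne] using p 1 by auto
    have m: "port_mark N C' x y = port_mark N C x y" "port_mark N C' y x = port_mark N C y x"
      using wb 1 by (auto simp: port_mark_def C')
    have "edge_inv C x y" using wf xy by (rule wf_edge)
    then show ?thesis by (simp add: edge_inv_def flow_def c m)
  qed
  ultimately show ?thesis unfolding wf_config_def by blast
qed

lemma wf_compute_step:
  assumes wf: "wf_config C" and a: "a \<in> A"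
  shows "wf_config (compute_step N A a C)"
proof -
  obtain v q where vq: "pos C a = (v, q)" by fastforce
  let ?C' = "compute_step N A a C" and ?wb = "board C v" and ?d = "degree N v"
  show ?thesis
  proof (cases "v \<in> holes N")
    case True
    then show ?thesis using wf vq by (simp add: compute_step_hole)
  next
    case nh: False
    have stay: "wf_config ?C'" if "A_infty ?d (crowd_at A C v) q ?wb = (q, ?wb)"
    proof -
      have "?C' = C" using that vq by (simp add: compute_step_def fun_upd_idem)
      then show ?thesis using wf by simp
    qed
    have C': "?C' = C\<lparr>pos := (pos C)(a := (v, q')), board := (board C)(v := wb')\<rparr>"
      if "A_infty ?d (crowd_at A C v) q ?wb = (q', wb')" for q' wb'
      using that vq nh by (simp add: compute_step_def)
    consider (center) "v \<in> safe_nodes N" "q = Center"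
      | (ingoing) w where "{v, w} \<in> edges N" "q = Ingoing (label N v w)"
      | (outgoing) w where "{v, w} \<in> edges N" "q = Outgoing (label N v w)"
      using wf_placed[OF wf a] vq by (auto simp: placed_def)
    then show ?thesis
    proof cases
      case outgoing
      then show ?thesis using stay by simp
    next
      case center
      show ?thesis
      proof (cases "first_candidate ?d (crowd_at A C v) ?wb")
        case None
        then show ?thesis using stay center by simp
      next
        case (Some j)
        then obtain k where "k < ?d" "j = (rotor ?wb + k) mod ?d" and cand: "candidate (crowd_at A C v) ?wb j"
          using first_candidate_Some by blast
        then have "j < ?d" by simp
        then obtain w where vw: "{v, w} \<in> edges N" and j: "j = label N v w"
          using label_cases center by (auto simp: safe_nodes_def)
        have wv: "{w, v} \<in> edges N" and [simp]: "v \<noteq> w" "w \<noteq> v"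
          using vw edge_nodes by (auto simp: insert_commute)
        define wb' where "wb' = \<lparr>rotor = (j + 1) mod ?d,
            ports = (if ports ?wb j = Unexplored then (ports ?wb)(j := Dangerous) else ports ?wb)\<rparr>"
        have eq: "?C' = C\<lparr>pos := (pos C)(a := out v w), board := (board C)(v := wb')\<rparr>"
          unfolding j[symmetric] by (rule C') (simp add: center Some wb'_def)
        have ne: "out v w \<noteq> pos C a" using vq center by simp
        note e = wf_edge[OF wf vw] wf_edge[OF wf wv]
        have c: "crowd_at A ?C' v (Outgoing (label N v w)) = 1"
          "crowd_at A C v (Outgoing (label N v w)) = 0"
          "crowd_at A C v (Ingoing (label N v w)) = 0"
          "crowd_at A ?C' w (Ingoing (label N w v)) = crowd_at A C w (Ingoing (label N w v))"
          "crowd_at A ?C' w (Outgoing (label N w v)) = crowd_at A C w (Outgoing (label N w v))"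
          "crowd_at A ?C' v (Ingoing (label N v w)) = 0"
          unfolding eq crowd_at_relocate[OF fin a ne] using cand vq center
          by (auto simp: candidate_def j)
        have m: "port_mark N C v w \<noteq> Dangerous" "port_mark N ?C' w v = port_mark N C w v"
          "port_mark N ?C' v w = (if port_mark N C v w = Unexplored then Dangerous else port_mark N C v w)"
          using cand by (auto simp: eq port_mark_def wb'_def j candidate_def)
        \<comment> \<open>The sub-ports of a candidate are empty, so the bound of one agent
          survives. If the port was UNEXPLORED, the flow from \<open>v\<close> to \<open>w\<close>
          was 0 and becomes exactly 1, as the new mark DANGEROUS demands.\<close>
        have "edge_inv ?C' v w" "edge_inv ?C' w v"
          using e m unfolding edge_inv_def flow_def c
          by (cases "port_mark N C v w"; cases "port_mark N C w v"; simp)+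
        then show ?thesis
          using vq center by (intro wf_relocate[OF wf a vw _ _ eq]) (auto simp: wb'_def j)
      qed
    next
      case ingoing
      have safe: "v \<in> safe_nodes N"
        using nh edge_nodes[OF ingoing(1)] by (simp add: safe_nodes_def)
      have wv: "{w, v} \<in> edges N" and [simp]: "v \<noteq> w" "w \<noteq> v"
        using ingoing(1) edge_nodes by (auto simp: insert_commute)
      note e = wf_edge[OF wf ingoing(1)] wf_edge[OF wf wv]
      define wb' where "wb' = snd (A_infty ?d (crowd_at A C v) q ?wb)"
      define q' where "q' = fst (A_infty ?d (crowd_at A C v) q ?wb)"
      have eq: "?C' = C\<lparr>pos := (pos C)(a := (v, q')), board := (board C)(v := wb')\<rparr>"
        by (rule C') (simp add: wb'_def q'_def)
      have q': "q' = (if port_mark N C v w = Unexplored then Outgoing (label N v w) else Center)"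
        by (auto simp: q'_def ingoing port_mark_def split: mark.split)
      have ne: "(v, q') \<noteq> pos C a" using vq ingoing q' by simp
      have "0 < crowd_at A C v (Ingoing (label N v w))"
        unfolding crowd_at_pos_iff[OF fin] using a vq ingoing by blast
      moreover have "crowd_at A ?C' v (Outgoing (label N v w)) =
            (if port_mark N C v w = Unexplored then Suc (crowd_at A C v (Outgoing (label N v w)))
             else crowd_at A C v (Outgoing (label N v w)))"
          "crowd_at A ?C' v (Ingoing (label N v w)) = crowd_at A C v (Ingoing (label N v w)) - 1"
          "crowd_at A ?C' w (Ingoing (label N w v)) = crowd_at A C w (Ingoing (label N w v))"
          "crowd_at A ?C' w (Outgoing (label N w v)) = crowd_at A C w (Outgoing (label N w v))"
        unfolding eq crowd_at_relocate[OF fin a ne] using vq ingoing q' by auto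
      moreover have "port_mark N ?C' w v = port_mark N C w v" "port_mark N ?C' v w = Safe"
        by (auto simp: eq port_mark_def wb'_def ingoing split: mark.splits)
      \<comment> \<open>The agent came from \<open>w\<close>, so the mark at \<open>w\<close> is not
        UNEXPLORED. If it is DANGEROUS, the SAFE mark at \<open>v\<close> requires flow from
        \<open>v\<close> to \<open>w\<close>: an UNEXPLORED port sends the agent back to supply it,
        and in the other cases the old invariant already gives it.\<close>
      ultimately have "edge_inv ?C' v w" "edge_inv ?C' w v"
        using e unfolding edge_inv_def flow_def
        by (cases "port_mark N C v w"; cases "port_mark N C w v"; simp)+
      moreover have "ports wb' j = ports ?wb j" if "j \<noteq> label N v w" for j
        using that by (auto simp: wb'_def ingoing split: mark.splits)
      ultimately show ?thesis
        using vq ingoing q' by (intro wf_relocate[OF wf a ingoing(1) safe _ eq]) auto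
    qed
  qed
qed

lemma wf_micro_aux: "wf_config C \<Longrightarrow> set as \<subseteq> A \<Longrightarrow> wf_config (fold (compute_step N A) as C)"
  by (induction as arbitrary: C) (auto intro: wf_compute_step)

lemma wf_X: "wf_config (X t)"
proof (induction t)
  case 0
  have c: "crowd_at A (X 0) v (Ingoing j) = 0" "crowd_at A (X 0) v (Outgoing j) = 0" for v j
    by (simp_all add: crowd_at_def)
  have "edge_inv (X 0) v w" for v w
    unfolding edge_inv_def flow_def c by (simp add: port_mark_def)
  moreover have "placed (X 0) a" if "a \<in> A" for a
    using start that by (simp add: placed_def)
  ultimately show ?case by (simp add: wf_config_def)
next
  case (Suc t)
  then show ?case using wf_micro_aux wf_move_step act_set by simp
qed

lemma wf_micro: "wf_config (micro t i)"
  unfolding micro_def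
  by (rule wf_micro_aux[OF wf_X]) (meson act_set order_trans set_take_subset)

subsection \<open>Single rounds\<close>

lemma micro_0: "micro t 0 = X t"
  by (simp add: micro_def)

lemma micro_Suc: "i < length (act t) \<Longrightarrow> micro t (Suc i) = compute_step N A (act t ! i) (micro t i)"
  by (simp add: micro_def take_Suc_conv_app_nth)

lemma X_Suc: "X (Suc t) = move_step N t (set (act t)) (micro t (length (act t)))"
  by (simp add: micro_def)

lemma pos_micro_idle:
  assumes "a \<notin> set (act t)" "i \<le> length (act t)"
  shows "pos (micro t i) a = pos (X t) a"
  using assms(2)
proof (induction i)
  case (Suc i)
  then have "act t ! i \<noteq> a" using assms(1) by (auto simp: in_set_conv_nth)
  then show ?case using Suc by (simp add: micro_Suc compute_step_pos_other)
qed (simp add: micro_0)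

lemma pos_X_idle: "a \<notin> set (act t) \<Longrightarrow> pos (X (Suc t)) a = pos (X t) a"
  using pos_micro_idle[of a t "length (act t)"] by (simp only: X_Suc) (simp add: move_step_def)

text \<open>Since \<open>act t\<close> is distinct, the agent has a single Compute step, at index
  \<open>k\<close>, and steps of other agents do not move it.\<close>

lemma active_round:
  assumes "a \<in> set (act t)"
  shows "\<exists>k<length (act t). act t ! k = a \<and>
    (\<forall>i\<le>k. pos (micro t i) a = pos (X t) a) \<and>
    (\<forall>i\<le>length (act t). k < i \<longrightarrow> pos (micro t i) a = pos (micro t (Suc k)) a) \<and>
    pos (X (Suc t)) a = cross N t (pos (micro t (Suc k)) a)"
proof -
  obtain k where k: "k < length (act t)" "act t ! k = a"
    using assms by (auto simp: in_set_conv_nth)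
  have other: "act t ! i \<noteq> a" if "i < length (act t)" "i \<noteq> k" for i
    using k that act_distinct nth_eq_iff_index_eq by metis
  have before: "pos (micro t i) a = pos (X t) a" if "i \<le> k" for i
    using that
  proof (induction i)
    case (Suc i)
    then show ?case using other[of i] k by (simp add: micro_Suc compute_step_pos_other)
  qed (simp add: micro_0)
  have after: "pos (micro t i) a = pos (micro t (Suc k)) a" if "k < i" "i \<le> length (act t)" for i
    using that
  proof (induction i)
    case (Suc i)
    then show ?case
      using other[of i] by (cases "i = k") (simp_all add: micro_Suc compute_step_pos_other)
  qed simp
  have "pos (X (Suc t)) a = cross N t (pos (micro t (Suc k)) a)"
    using after[of "length (act t)"] k assms by (simp only: X_Suc) (simp add: move_step_def)
  then show ?thesis using k before after by blast
qed

lemma mark_deficit_micro: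
  assumes "i \<le> i'" "i' \<le> length (act t)"
  shows "mark_deficit (ports (board (micro t i') v) j) \<le> mark_deficit (ports (board (micro t i) v) j)"
  using assms
proof (induction i' rule: dec_induct)
  case (step n)
  then show ?case using compute_step_mark_deficit[of N A "act t ! n" "micro t n" v j]
    by (simp add: micro_Suc)
qed simp

lemma board_X_Suc: "board (X (Suc t)) = board (micro t (length (act t)))"
  by (simp only: X_Suc) (simp add: move_step_def)

subsection \<open>Final marks and recurring places\<close>

text \<open>All stages of a round are covered, not only its start, because agents read the board
  between the Compute steps of others.\<close>

definition stable_mark :: "'v \<Rightarrow> nat \<Rightarrow> mark \<Rightarrow> bool" where
  "stable_mark v j m \<longleftrightarrow>
     (\<forall>\<^sub>F t in sequentially. \<forall>i\<le>length (act t). ports (board (micro t i) v) j = m)"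

lemma stable_mark_exists: "\<exists>m. stable_mark v j m"
proof -
  define g where "g t = mark_deficit (ports (board (X t) v) j)" for t
  have "g (Suc t) \<le> g t" for t
    unfolding g_def board_X_Suc using mark_deficit_micro[of 0 "length (act t)" t] by (simp add: micro_0)
  then obtain T where T: "\<And>t. t \<ge> T \<Longrightarrow> g t = g T"
    using eventually_constant_if_nonincreasing[of 0 g] by blast
  have "ports (board (micro t i) v) j = ports (board (X T) v) j"
    if t: "t \<ge> T" and i: "i \<le> length (act t)" for t i
  proof -
    \<comment> \<open>Inside a round the deficit lies between its values at the two ends, and these
      agree once \<open>g\<close> is constant.\<close>
    have "mark_deficit (ports (board (micro t i) v) j) \<le> g t"
      using mark_deficit_micro[of 0 i t v j] i by (simp add: g_def micro_0)
    moreover have "g (Suc t) \<le> mark_deficit (ports (board (micro t i) v) j)"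
      unfolding g_def board_X_Suc using mark_deficit_micro[of i "length (act t)" t v j] i by simp
    ultimately have "mark_deficit (ports (board (micro t i) v) j) = g T"
      using T[OF t] T[of "Suc t"] t by simp
    then show ?thesis by (simp add: g_def mark_deficit_inject)
  qed
  then show ?thesis unfolding stable_mark_def eventually_sequentially by blast
qed

lemma stable_mark_unique:
  assumes "stable_mark v j m" "stable_mark v j m'"
  shows "m = m'"
proof -
  have "\<forall>\<^sub>F t in sequentially. m = m'"
    using assms unfolding stable_mark_def by eventually_elim blast
  then show ?thesis by simp
qed

definition occ :: "'v \<times> place \<Rightarrow> bool" where
  "occ p \<longleftrightarrow> (\<exists>\<^sub>F t in sequentially. \<exists>a\<in>A. pos (X t) a = p)"

text \<open>Activation is required in addition to presence, as only a Compute step at the center can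
  advance the rotor; fairness supplies it in \<open>occ_center_engaged\<close>.\<close>

definition engaged :: "'v \<Rightarrow> bool" where
  "engaged v \<longleftrightarrow> (\<exists>\<^sub>F t in sequentially. \<exists>a\<in>set (act t). pos (X t) a = (v, Center))"

lemma next_activation:
  assumes "a \<in> A"
  obtains t' where "t' \<ge> t" "a \<in> set (act t')" "pos (X t') a = pos (X t) a"
proof -
  define t' where "t' = (LEAST t'. t' \<ge> t \<and> a \<in> set (act t'))"
  have t': "t' \<ge> t" "a \<in> set (act t')"
    using LeastI_ex[of "\<lambda>t'. t' \<ge> t \<and> a \<in> set (act t')"] fairness[OF assms, of t]
    by (auto simp: t'_def)
  have "s \<le> t' \<Longrightarrow> pos (X s) a = pos (X t) a" if "t \<le> s" for s
    using that
  proof (induction s rule: dec_induct)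
    case (step s)
    then have "a \<notin> set (act s)"
      using not_less_Least[of s "\<lambda>t'. t' \<ge> t \<and> a \<in> set (act t')"] by (auto simp: t'_def)
    then show ?case using step pos_X_idle by (metis Suc_leD)
  qed simp
  then show ?thesis using that t' by blast
qed

lemma compute_outgoing:
  assumes "pos C a = (v, Outgoing j)"
  shows "pos (compute_step N A a C) a = (v, Outgoing j)"
  using assms by (cases "v \<in> holes N") (simp_all add: compute_step_hole compute_step_pos)

lemma cross_out:
  assumes "{v, w} \<in> edges N"
  shows "cross N t (out v w) = (if present N {v, w} t then ing w v else out v w)"
  using far_end_label[OF assms] by (simp add: Let_def)

text \<open>The agent crosses in the first round in which it is active while the edge is present.
  Until then it stays on its sub-port, being either inactive or stopped by the absent edge.\<close>

lemma transport:
  assumes a: "a \<in> A" and vw: "{v, w} \<in> edges N" "recurrent N {v, w}" and p: "pos (X t) a = out v w"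
  obtains t' where "t' > t" "pos (X t') a = ing w v"
proof -
  let ?P = "\<lambda>t'. t' \<ge> t \<and> a \<in> set (act t') \<and> present N {v, w} t'"
  define t' where "t' = Least ?P"
  have "\<exists>t'. ?P t'" using sched a vw p unfolding ssynch_def eventual_transport_def by blast
  then have t': "?P t'" unfolding t'_def by (rule LeastI_ex)
  have crossing: "pos (X (Suc s)) a = cross N s (out v w)"
    if active: "a \<in> set (act s)" and "pos (X s) a = out v w" for s
  proof -
    obtain k where "k < length (act s)" "act s ! k = a" "pos (micro s k) a = pos (X s) a"
      "pos (X (Suc s)) a = cross N s (pos (micro s (Suc k)) a)"
      using active_round[OF active] by (metis order_refl)
    then show ?thesis using that(2) by (simp add: micro_Suc compute_outgoing)
  qed
  have "s \<le> t' \<Longrightarrow> pos (X s) a = out v w" if "t \<le> s" for s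
    using that
  proof (induction s rule: dec_induct)
    case (step s)
    then have "\<not> ?P s" using not_less_Least[of s ?P] by (auto simp: t'_def)
    then consider "a \<notin> set (act s)" | "a \<in> set (act s)" "\<not> present N {v, w} s"
      using step by auto
    then show ?case
    proof cases
      case 1
      then show ?thesis using step pos_X_idle by (metis Suc_leD)
    next
      case 2
      then show ?thesis
        using crossing[of s] step cross_out[OF vw(1)]
        by simp
    qed
  qed (use p in simp)
  then have "pos (X t') a = out v w" using t' by blast
  then have "pos (X (Suc t')) a = ing w v" using crossing[of t'] t' cross_out[OF vw(1)] by simp
  then show ?thesis using that[of "Suc t'"] t' by simp
qed

lemma occ_center_engaged:
  assumes "occ (v, Center)"
  shows "engaged v"
  using assms unfolding engaged_def occ_def
  by (rule frequently_sequentially_later) (metis next_activation)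

lemma occ_out_ing:
  assumes "occ (out v w)" "{v, w} \<in> edges N" "recurrent N {v, w}"
  shows "occ (ing w v)"
  using assms(1) unfolding occ_def
  by (rule frequently_sequentially_later) (metis transport assms(2,3) less_imp_le)

text \<open>Every Compute step on an ingoing sub-port leaves the mark SAFE. If the mark is the same
  throughout the round, it was SAFE before, and then the agent goes to the center.\<close>

lemma activated_ingoing:
  assumes "a \<in> set (act t)" "pos (X t) a = (v, Ingoing j)" "v \<notin> holes N"
    and st: "\<forall>i\<le>length (act t). ports (board (micro t i) v) j = m"
  shows "m = Safe \<and> pos (X (Suc t)) a = (v, Center)"
proof -
  obtain k where k: "k < length (act t)" "act t ! k = a" "pos (micro t k) a = pos (X t) a"
      "pos (X (Suc t)) a = cross N t (pos (micro t (Suc k)) a)"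
    using active_round[OF assms(1)] by (metis order_refl)
  have m: "ports (board (micro t k) v) j = m" "ports (board (micro t (Suc k)) v) j = m"
    using st k(1) by auto
  have p: "pos (micro t k) a = (v, Ingoing j)" using k assms by simp
  have "m = Safe"
    using m(2) unfolding micro_Suc[OF k(1)] k(2) compute_step_board[OF p assms(3)]
    using m(1) by (cases m) auto
  moreover have "pos (micro t (Suc k)) a = (v, Center)"
    unfolding micro_Suc[OF k(1)] k(2) compute_step_pos[OF p assms(3)] using m(1) \<open>m = Safe\<close> by simp
  ultimately show ?thesis using k(4) by simp
qed

lemma occ_ing:
  assumes "occ (v, Ingoing j)" "v \<notin> holes N"
  shows "stable_mark v j Safe" "occ (v, Center)"
proof -
  obtain m where m: "stable_mark v j m" using stable_mark_exists by blast
  have "\<exists>\<^sub>F t in sequentially. \<exists>a\<in>set (act t). pos (X t) a = (v, Ingoing j)"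
    using assms(1) unfolding occ_def
    by (rule frequently_sequentially_later) (metis next_activation)
  from frequently_eventually_conj[OF this m[unfolded stable_mark_def]]
  have "\<exists>\<^sub>F t in sequentially. m = Safe \<and> (\<exists>a\<in>A. pos (X (Suc t)) a = (v, Center))"
    by (rule frequently_elim1) (use activated_ingoing assms(2) act_set in blast)
  then have "m = Safe" "\<exists>\<^sub>F t in sequentially. \<exists>a\<in>A. pos (X (Suc t)) a = (v, Center)"
    by (auto dest: frequently_ex elim: frequently_elim1)
  then show "stable_mark v j Safe" "occ (v, Center)"
    using m frequently_sequentially_later[of "\<lambda>t. \<exists>a\<in>A. pos (X (Suc t)) a = (v, Center)"
        "\<lambda>t. \<exists>a\<in>A. pos (X t) a = (v, Center)"] le_SucI
    unfolding occ_def by blast+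
qed

text \<open>Ingoing sub-ports are entered by crossing only, never in a Compute step.\<close>

lemma ingoing_before:
  assumes "pos (micro t i) a = (v, Ingoing j)" "i \<le> length (act t)"
  shows "pos (X t) a = (v, Ingoing j)"
proof (cases "a \<in> set (act t)")
  case False
  then show ?thesis using pos_micro_idle assms by simp
next
  case True
  then obtain k where k: "k < length (act t)" "act t ! k = a" "pos (micro t k) a = pos (X t) a"
    "pos (micro t i) a = pos (X t) a \<or> pos (micro t i) a = pos (micro t (Suc k)) a"
    using active_round[OF True] assms(2) by (metis leI order_refl)
  obtain u q where u: "pos (micro t k) a = (u, q)" by fastforce
  show ?thesis
  proof (cases "u \<in> holes N")
    case True
    then show ?thesis using k u assms micro_Suc compute_step_hole by metis
  next
    case False
    have "pos (micro t (Suc k)) a \<noteq> (v, Ingoing j)"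
      unfolding micro_Suc[OF k(1)] k(2) compute_step_pos[OF u False] using A_infty_not_ingoing by auto
    then show ?thesis using k assms by simp
  qed
qed

lemma outgoing_before:
  assumes "pos (micro t i) a = (v, Outgoing j)" "i \<le> length (act t)"
  shows "pos (X t) a \<in> {(v, Center), (v, Ingoing j), (v, Outgoing j)}"
proof (cases "a \<in> set (act t)")
  case False
  then show ?thesis using pos_micro_idle assms by simp
next
  case True
  then obtain k where k: "k < length (act t)" "act t ! k = a" "pos (micro t k) a = pos (X t) a"
    "pos (micro t i) a = pos (X t) a \<or> pos (micro t i) a = pos (micro t (Suc k)) a"
    using active_round[OF True] assms(2) by (metis leI order_refl)
  obtain u q where u: "pos (micro t k) a = (u, q)" by fastforce
  show ?thesis
  proof (cases "u \<in> holes N")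
    case True
    then have "pos (micro t (Suc k)) a = pos (X t) a"
      using k u micro_Suc compute_step_hole by metis
    then show ?thesis using k assms by auto
  next
    case False
    have "pos (micro t (Suc k)) a = (v, Outgoing j) \<Longrightarrow> u = v \<and> q \<in> {Center, Ingoing j, Outgoing j}"
      unfolding micro_Suc[OF k(1)] k(2) compute_step_pos[OF u False]
      by (cases q) (auto split: mark.splits)
    then show ?thesis using k u assms by auto
  qed
qed

text \<open>Turns a sighting within a round into one at the start of the next round.\<close>

lemma outgoing_after:
  assumes "pos (micro t i) a = out v w" "i \<le> length (act t)" "{v, w} \<in> edges N"
  shows "pos (X (Suc t)) a \<in> {out v w, ing w v}"
proof (cases "a \<in> set (act t)")
  case False
  then show ?thesis using pos_micro_idle assms pos_X_idle by simp
next
  case True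
  then obtain k where k: "k < length (act t)" "act t ! k = a" "pos (micro t k) a = pos (X t) a"
    "pos (micro t i) a = pos (X t) a \<or> pos (micro t i) a = pos (micro t (Suc k)) a"
    "pos (X (Suc t)) a = cross N t (pos (micro t (Suc k)) a)"
    using active_round[OF True] assms(2) by (metis leI order_refl)
  have "pos (micro t (Suc k)) a = out v w"
    using k assms compute_outgoing by (metis micro_Suc)
  then show ?thesis using k cross_out[OF assms(3)] by simp
qed

lemma eventually_no_occ:
  "\<not> occ p \<longleftrightarrow> (\<forall>\<^sub>F t in sequentially. \<forall>a\<in>A. pos (X t) a \<noteq> p)"
  by (simp add: occ_def not_frequently)

text \<open>After the last entry, each agent that has once been away from \<open>p\<close> stays
  away; as the team is finite, a common time exists after which \<open>p\<close> is empty.\<close>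

lemma not_occ_if_no_entry:
  assumes entry: "\<forall>\<^sub>F t in sequentially. \<forall>a\<in>A. pos (X (Suc t)) a = p \<longrightarrow> pos (X t) a = p"
    and leave: "\<forall>\<^sub>F t in sequentially. \<forall>a\<in>A. pos (X t) a = p \<longrightarrow> (\<exists>t'\<ge>t. pos (X t') a \<noteq> p)"
  shows "\<not> occ p"
proof -
  obtain T where T: "\<And>t a. t \<ge> T \<Longrightarrow> a \<in> A \<Longrightarrow> pos (X (Suc t)) a = p \<Longrightarrow> pos (X t) a = p"
    "\<And>t a. t \<ge> T \<Longrightarrow> a \<in> A \<Longrightarrow> pos (X t) a = p \<Longrightarrow> \<exists>t'\<ge>t. pos (X t') a \<noteq> p"
    using eventually_conj[OF entry leave] unfolding eventually_sequentially by blast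
  have "\<forall>\<^sub>F t in sequentially. pos (X t) a \<noteq> p" if a: "a \<in> A" for a
  proof -
    obtain t' where t': "t' \<ge> T" "pos (X t') a \<noteq> p" using T(2)[OF order_refl a] by (cases "pos (X T) a = p") auto
    have "pos (X s) a \<noteq> p" if "t' \<le> s" for s
      using that by (induction s rule: dec_induct) (use t' T(1) a in auto)
    then show ?thesis unfolding eventually_sequentially by blast
  qed
  then show ?thesis unfolding eventually_no_occ using fin by (simp add: eventually_ball_finite)
qed

text \<open>
  Needed because a port can be skipped forever when the rotor always passes while agents stand
  on its ingoing sub-port.
\<close>

lemma occ_ing_engaged_source:
  assumes occ: "occ (ing v u)" and vu: "{v, u} \<in> edges N" and rec: "recurrent N {v, u}"
    and safe: "v \<notin> holes N" "u \<notin> holes N"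
  shows "engaged u"
proof (rule ccontr)
  assume "\<not> engaged u"
  then have no_center: "\<not> occ (u, Center)" using occ_center_engaged by blast
  then have no_ing: "\<not> occ (ing u v)" using occ_ing(2) safe by blast
  have uv: "{u, v} \<in> edges N" "recurrent N {u, v}" "u \<noteq> v"
    using vu rec edge_nodes by (auto simp: insert_commute)
  \<comment> \<open>Once the center of \<open>u\<close> and its ingoing sub-port from
    \<open>v\<close> stay empty, nobody steps onto \<open>out u v\<close> any more. The edge is
    recurrent, so this place drains first, and then \<open>ing v u\<close>, which is fed from it
    alone.\<close>
  have from_out: "pos (X t) a = out u v"
    if "pos (micro t i) a = out u v" "i \<le> length (act t)" "a \<in> A"
      "\<forall>a\<in>A. pos (X t) a \<noteq> (u, Center)" "\<forall>a\<in>A. pos (X t) a \<noteq> ing u v" for t i a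
    using outgoing_before[OF that(1,2)] that by blast
  have entered: "pos (X (Suc t)) a = pos (X t) a \<or>
      (\<exists>i\<le>length (act t). pos (X (Suc t)) a = cross N t (pos (micro t i) a))" for t a
    using active_round[of a t] pos_X_idle[of a t] by (meson Suc_leI)
  have "\<not> occ (out u v)"
  proof (rule not_occ_if_no_entry)
    show "\<forall>\<^sub>F t in sequentially. \<forall>a\<in>A. pos (X (Suc t)) a = out u v \<longrightarrow> pos (X t) a = out u v"
      using no_center[unfolded eventually_no_occ] no_ing[unfolded eventually_no_occ]
    proof eventually_elim
      case (elim t)
      show ?case
      proof (intro ballI impI)
        fix a assume a: "a \<in> A" and p: "pos (X (Suc t)) a = out u v"
        show "pos (X t) a = out u v"
        proof (cases "pos (X (Suc t)) a = pos (X t) a")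
          case False
          then obtain i where i: "i \<le> length (act t)" "cross N t (pos (micro t i) a) = out u v"
            using entered[of t a] p by auto
          then have "pos (micro t i) a = out u v"
            by (cases "(N, t, pos (micro t i) a)" rule: cross.cases)
              (auto simp: Let_def split: if_splits)
          then show ?thesis using from_out i a elim by blast
        qed (use p in simp)
      qed
    qed
    have "\<exists>t'\<ge>t. pos (X t') a \<noteq> out u v" if "a \<in> A" "pos (X t) a = out u v" for a t
      using transport[OF that(1) uv(1,2) that(2)] by (metis less_imp_le place.distinct(5) prod.inject)
    then show "\<forall>\<^sub>F t in sequentially. \<forall>a\<in>A. pos (X t) a = out u v \<longrightarrow>
        (\<exists>t'\<ge>t. pos (X t') a \<noteq> out u v)" by simp
  qed
  note no_out = this
  have "\<not> occ (ing v u)"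
  proof (rule not_occ_if_no_entry)
    show "\<forall>\<^sub>F t in sequentially. \<forall>a\<in>A. pos (X (Suc t)) a = ing v u \<longrightarrow> pos (X t) a = ing v u"
      using no_center[unfolded eventually_no_occ] no_ing[unfolded eventually_no_occ]
        no_out[unfolded eventually_no_occ]
    proof eventually_elim
      case (elim t)
      show ?case
      proof (intro ballI impI)
        fix a assume a: "a \<in> A" and p: "pos (X (Suc t)) a = ing v u"
        show "pos (X t) a = ing v u"
        proof (cases "pos (X (Suc t)) a = pos (X t) a")
          case False
          then obtain i where i: "i \<le> length (act t)" "cross N t (pos (micro t i) a) = ing v u"
            using entered[of t a] p by auto
          have "placed (micro t i) a" using wf_placed[OF wf_micro a] .
          then consider "pos (micro t i) a = ing v u"
            | x y where "{x, y} \<in> edges N" "pos (micro t i) a = out x y"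
            using i(2) unfolding placed_def by auto
          then show ?thesis
          proof cases
            case 1
            then show ?thesis using ingoing_before i(1) by blast
          next
            case 2
            then have "ing y x = ing v u" using i(2) cross_out[OF 2(1), of t] by (auto split: if_splits)
            then have "y = v" "x = u"
              using label_inject[of v x u] 2(1) vu by (auto simp: insert_commute)
            then show ?thesis using 2 from_out i a elim by blast
          qed
        qed (use p in simp)
      qed
    qed
    obtain m where "stable_mark v (label N v u) m" using stable_mark_exists by blast
    then obtain T where T: "\<And>t. t \<ge> T \<Longrightarrow> \<forall>i\<le>length (act t). ports (board (micro t i) v) (label N v u) = m"
      unfolding stable_mark_def eventually_sequentially by blast
    have "\<exists>t'\<ge>t. pos (X t') a \<noteq> ing v u" if "a \<in> A" "pos (X t) a = ing v u" "t \<ge> T" for a t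
    proof -
      obtain t' where t': "t' \<ge> t" "a \<in> set (act t')" "pos (X t') a = pos (X t) a"
        using next_activation[OF \<open>a \<in> A\<close>] by blast
      then have "pos (X (Suc t')) a = (v, Center)"
        using activated_ingoing[OF t'(2) _ safe(1) T] that by auto
      then have "pos (X (Suc t')) a \<noteq> ing v u" by simp
      then show ?thesis using t'(1) le_SucI by blast
    qed
    then show "\<forall>\<^sub>F t in sequentially. \<forall>a\<in>A. pos (X t) a = ing v u \<longrightarrow>
        (\<exists>t'\<ge>t. pos (X t') a \<noteq> ing v u)" unfolding eventually_sequentially by blast
  qed
  then show False using occ by blast
qed

section \<open>Use of the ports at engaged nodes\<close>

text \<open>Otherwise, from some time on, each Compute step at the center finds \<open>j\<close> a
  candidate and takes another port. Each of them lowers the rotor distance to \<open>j\<close>, the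
  remaining steps keep the rotor, and infinitely many of them would be an infinite descent.\<close>

lemma engaged_tries_port:
  assumes eng: "engaged v" and safe: "v \<notin> holes N" and j: "j < degree N v"
  shows "\<exists>\<^sub>F t in sequentially. \<exists>i<length (act t). pos (micro t i) (act t ! i) = (v, Center) \<and>
    (first_candidate (degree N v) (crowd_at A (micro t i) v) (board (micro t i) v) = Some j \<or>
     \<not> candidate (crowd_at A (micro t i) v) (board (micro t i) v) j)"
    (is "\<exists>\<^sub>F t in _. \<exists>i<_. ?c t i \<and> (?f t i = Some j \<or> \<not> ?cand t i)")
proof (rule ccontr)
  assume "\<not> ?thesis"
  then have "\<forall>\<^sub>F t in sequentially. \<forall>i<length (act t). ?c t i \<longrightarrow> ?f t i \<noteq> Some j \<and> ?cand t i"
    unfolding not_frequently by (rule eventually_mono) blast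
  then obtain T where T: "\<And>t i. t \<ge> T \<Longrightarrow> i < length (act t) \<Longrightarrow> ?c t i \<Longrightarrow> ?f t i \<noteq> Some j \<and> ?cand t i"
    unfolding eventually_sequentially by blast
  define h where "h t i = rotor_dist (degree N v) j (rotor (board (micro t i) v))" for t i
  have strict: "h t (Suc i) < h t i" if t: "t \<ge> T" and i: "i < length (act t)" and c: "?c t i" for t i
  proof -
    obtain c' where c': "?f t i = Some c'" "c' \<noteq> j"
      using T[OF t i c] first_candidate_None[OF _ j] by (cases "?f t i") auto
    have "rotor (board (micro t (Suc i)) v) = (c' + 1) mod degree N v"
      unfolding micro_Suc[OF i] compute_step_board[OF c safe] using c' by simp
    then show ?thesis
      using rotor_dist_decreases[OF j _ c'] T[OF t i c] by (simp add: h_def)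
  qed
  have weak: "h t (Suc i) \<le> h t i" if "t \<ge> T" "i < length (act t)" for t i
  proof (cases "?c t i")
    case True
    then show ?thesis using strict that by (simp add: less_imp_le)
  next
    case False
    obtain u q where u: "pos (micro t i) (act t ! i) = (u, q)" by fastforce
    have "rotor (board (micro t (Suc i)) v) = rotor (board (micro t i) v)"
    proof (cases "u = v")
      case True
      then show ?thesis
        unfolding micro_Suc[OF that(2)] using False u compute_step_board[of _ _ v q N A] safe
        by (cases q) (auto split: mark.splits)
    next
      case False
      then show ?thesis
        unfolding micro_Suc[OF that(2)] using u by (simp add: compute_step_board_other)
    qed
    then show ?thesis by (simp add: h_def)
  qed
  have mono: "h t i' \<le> h t i" if "t \<ge> T" "i \<le> i'" "i' \<le> length (act t)" for t i i'
    using that(2,3)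
  proof (induction i' rule: dec_induct)
    case (step n)
    then show ?case using weak[OF that(1), of n] by simp
  qed simp
  have next_h: "h (Suc t) 0 = h t (length (act t))" for t
    by (simp only: h_def micro_0 board_X_Suc)
  have "h (Suc t) 0 < h t 0" if t: "t \<ge> T" and e: "\<exists>a\<in>set (act t). pos (X t) a = (v, Center)" for t
  proof -
    obtain a where a: "a \<in> set (act t)" "pos (X t) a = (v, Center)" using e by blast
    then obtain k where k: "k < length (act t)" "act t ! k = a" "pos (micro t k) a = pos (X t) a"
      using active_round by blast
    have "h (Suc t) 0 \<le> h t (Suc k)" unfolding next_h using mono[OF t] k(1) by simp
    also have "\<dots> < h t k" using strict[OF t] k a by simp
    also have "\<dots> \<le> h t 0" using mono[OF t] k(1) by simp
    finally show ?thesis .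
  qed
  then have "\<forall>\<^sub>F t in sequentially. (\<exists>a\<in>set (act t). pos (X t) a = (v, Center)) \<longrightarrow> h (Suc t) 0 < h t 0"
    by (intro eventually_sequentiallyI[of T]) blast
  then have "\<exists>\<^sub>F t in sequentially. h (Suc t) 0 < h t 0"
    using eng unfolding engaged_def by (rule frequently_mp)
  moreover have "\<forall>\<^sub>F t in sequentially. h (Suc t) 0 \<le> h t 0"
    using mono unfolding next_h eventually_sequentially by blast
  ultimately show False using not_eventually_strictly_decreasing[of "\<lambda>t. h t 0"] by blast
qed

text \<open>Intermediate configurations are needed: an agent can step onto the outgoing sub-port and
  cross in the same round, so that it is never there when a round starts.\<close>

definition passed :: "'v \<Rightarrow> 'v \<Rightarrow> bool" where
  "passed v w \<longleftrightarrow>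
     (\<exists>\<^sub>F t in sequentially. \<exists>a\<in>A. \<exists>i\<le>length (act t). pos (micro t i) a = out v w)"

lemma flow_posI:
  assumes "a \<in> A" "pos C a = out v w \<or> pos C a = ing w v"
  shows "flow C v w > 0"
  using assms crowd_at_pos_iff[OF fin, of C v "Outgoing (label N v w)"]
    crowd_at_pos_iff[OF fin, of C w "Ingoing (label N w v)"] unfolding flow_def by auto

lemma flow_posE:
  assumes "flow C v w > 0"
  obtains a where "a \<in> A" "pos C a = out v w \<or> pos C a = ing w v"
  using assms crowd_at_pos_iff[OF fin, of C v "Outgoing (label N v w)"]
    crowd_at_pos_iff[OF fin, of C w "Ingoing (label N w v)"] that unfolding flow_def
  by (metis add_is_0 neq0_conv)

lemma passed_occ:
  assumes "passed v w" "{v, w} \<in> edges N"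
  shows "occ (out v w) \<or> occ (ing w v)"
proof -
  have "\<exists>\<^sub>F t in sequentially. \<exists>a\<in>A. pos (X t) a = out v w \<or> pos (X t) a = ing w v"
    using assms(1) unfolding passed_def
    by (rule frequently_sequentially_later)
      (metis outgoing_after[OF _ _ assms(2)] insertE singletonD le_SucI order_refl)
  then show ?thesis unfolding occ_def frequently_disj_iff[symmetric]
    by (rule frequently_elim1) blast
qed

lemma passed_not_unexplored:
  assumes "passed v w" "{v, w} \<in> edges N"
  shows "\<not> stable_mark v (label N v w) Unexplored"
proof
  assume st: "stable_mark v (label N v w) Unexplored"
  have "\<exists>\<^sub>F t in sequentially. False"
    using frequently_eventually_conj[OF assms(1)[unfolded passed_def] st[unfolded stable_mark_def]]
  proof (rule frequently_elim1)
    fix t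
    assume *: "(\<forall>i\<le>length (act t). ports (board (micro t i) v) (label N v w) = Unexplored) \<and>
      (\<exists>a\<in>A. \<exists>i\<le>length (act t). pos (micro t i) a = out v w)"
    then obtain a i where "a \<in> A" "pos (micro t i) a = out v w" "port_mark N (micro t i) v w = Unexplored"
      unfolding port_mark_def by blast
    then show False
      using wf_edge[OF wf_micro assms(2), of t i] flow_posI[of a "micro t i" v w]
      by (simp add: edge_inv_def)
  qed
  then show False by simp
qed

text \<open>If port \<open>j\<close> is chosen, the agent is seen on its outgoing sub-port. If it is
  no candidate, the mark is DANGEROUS or one of the sub-ports is occupied. One of these reasons
  recurs forever.\<close>

lemma engaged_port:
  assumes eng: "engaged v" and safe: "v \<notin> holes N" and vw: "{v, w} \<in> edges N"
  shows "stable_mark v (label N v w) Dangerous \<or> occ (ing v w) \<or> passed v w"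
proof -
  let ?j = "label N v w"
  obtain m where m: "stable_mark v ?j m" using stable_mark_exists by blast
  have "\<exists>\<^sub>F t in sequentially. m = Dangerous \<or> (\<exists>a\<in>A. pos (X t) a = ing v w) \<or>
      (\<exists>a\<in>A. \<exists>i\<le>length (act t). pos (micro t i) a = out v w)"
    using frequently_eventually_conj[OF engaged_tries_port[OF eng safe label_less[OF vw]]
        m[unfolded stable_mark_def]]
  proof (rule frequently_elim1, elim conjE exE)
    fix t i
    let ?C = "micro t i"
    assume st: "\<forall>i\<le>length (act t). ports (board (micro t i) v) ?j = m" and i: "i < length (act t)"
      and c: "pos ?C (act t ! i) = (v, Center)"
      and "first_candidate (degree N v) (crowd_at A ?C v) (board ?C v) = Some ?j \<or>
        \<not> candidate (crowd_at A ?C v) (board ?C v) ?j"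
    then consider "first_candidate (degree N v) (crowd_at A ?C v) (board ?C v) = Some ?j"
      | "ports (board ?C v) ?j = Dangerous" | "0 < crowd_at A ?C v (Ingoing ?j)"
      | "0 < crowd_at A ?C v (Outgoing ?j)"
      unfolding candidate_def by blast
    then show "m = Dangerous \<or> (\<exists>a\<in>A. pos (X t) a = ing v w) \<or>
      (\<exists>a\<in>A. \<exists>i\<le>length (act t). pos (micro t i) a = out v w)"
    proof cases
      case 1
      then have "pos (micro t (Suc i)) (act t ! i) = out v w"
        unfolding micro_Suc[OF i] compute_step_pos[OF c safe] by simp
      moreover have "act t ! i \<in> A" using act_set i nth_mem by blast
      ultimately show ?thesis using i Suc_leI by blast
    next
      case 2
      then show ?thesis using st i by auto
    next
      case 3
      then show ?thesis unfolding crowd_at_pos_iff[OF fin] using ingoing_before i less_imp_le by blast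
    next
      case 4
      then show ?thesis unfolding crowd_at_pos_iff[OF fin] using i less_imp_le by blast
    qed
  qed
  then show ?thesis
    using m unfolding occ_def passed_def by (auto simp: frequently_disj_iff)
qed

text \<open>If the mark at \<open>v\<close> stayed DANGEROUS, the invariant would keep some flow
  positive forever: towards \<open>v\<close> if \<open>w\<close> ends up SAFE, towards
  \<open>w\<close> otherwise. On a recurrent edge this flow keeps arriving, and arrivals make the
  mark at the receiving end SAFE, a contradiction in both cases.\<close>

lemma recurrent_not_dangerous:
  assumes vw: "{v, w} \<in> edges N" "recurrent N {v, w}" and safe: "v \<notin> holes N" "w \<notin> holes N"
  shows "\<not> stable_mark v (label N v w) Dangerous"
proof
  assume st: "stable_mark v (label N v w) Dangerous"
  have wv: "{w, v} \<in> edges N" "recurrent N {w, v}" using vw by (simp_all add: insert_commute)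
  have occ_flow: "stable_mark y (label N y x) Safe"
    if xy: "{x, y} \<in> edges N" "recurrent N {x, y}" and "y \<notin> holes N"
      and "\<forall>\<^sub>F t in sequentially. flow (X t) x y > 0" for x y
  proof -
    have "\<exists>\<^sub>F t in sequentially. \<exists>a\<in>A. pos (X t) a = out x y \<or> pos (X t) a = ing y x"
      by (rule eventually_frequently, simp, rule eventually_mono[OF that(4)]) (metis flow_posE)
    then have "occ (out x y) \<or> occ (ing y x)"
      unfolding occ_def frequently_disj_iff[symmetric] by (rule frequently_elim1) blast
    then show ?thesis using occ_out_ing xy occ_ing(1) that(3) by blast
  qed
  obtain m where m: "stable_mark w (label N w v) m" using stable_mark_exists by blast
  have e: "\<forall>\<^sub>F t in sequentially. if m = Safe then flow (X t) w v > 0 else flow (X t) v w > 0"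
    using st[unfolded stable_mark_def] m[unfolded stable_mark_def]
  proof eventually_elim
    case (elim t)
    then have "port_mark N (X t) v w = Dangerous" "port_mark N (X t) w v = m"
      by (auto simp: port_mark_def micro_0 dest!: spec[of _ 0])
    then show ?case using wf_edge[OF wf_X vw(1), of t] by (auto simp: edge_inv_def)
  qed
  show False
  proof (cases "m = Safe")
    case True
    then have "stable_mark v (label N v w) Safe" using occ_flow[OF wv safe(1)] e by simp
    then show False using stable_mark_unique[OF st] by blast
  next
    case False
    then have "stable_mark w (label N w v) Safe" using occ_flow[OF vw safe(2)] e by simp
    then show False using stable_mark_unique[OF m] False by blast
  qed
qed

lemma engaged_recurrent_mark:
  assumes "engaged v" "{v, w} \<in> edges N" "recurrent N {v, w}" "v \<notin> holes N" "w \<notin> holes N"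
  shows "stable_mark v (label N v w) Safe"
proof -
  obtain m where m: "stable_mark v (label N v w) m" using stable_mark_exists by blast
  have "m \<noteq> Dangerous" using recurrent_not_dangerous assms m by blast
  moreover have "m \<noteq> Unexplored"
  proof
    assume "m = Unexplored"
    then have "occ (ing v w)"
      using engaged_port[OF assms(1,4,2)] m passed_not_unexplored[OF _ assms(2)]
        recurrent_not_dangerous assms by blast
    then show False using occ_ing(1) assms(4) stable_mark_unique[OF m] \<open>m = Unexplored\<close> by blast
  qed
  ultimately show ?thesis using m by (cases m) auto
qed

text \<open>Nothing flows out of a black hole, so the port is never SAFE and its ingoing sub-port is
  never occupied. By \<open>engaged_port\<close> it ends up DANGEROUS or is passed infinitely often,
  and neither fits the mark UNEXPLORED.\<close>

lemma engaged_dangerous_mark: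
  assumes "engaged v" "{v, b} \<in> edges N" "b \<in> holes N" "v \<notin> holes N"
  shows "stable_mark v (label N v b) Dangerous"
proof -
  obtain m where m: "stable_mark v (label N v b) m" using stable_mark_exists by blast
  have bv: "{b, v} \<in> edges N" using assms(2) by (simp add: insert_commute)
  have mark_inv: "flow (micro t i) b v = 0" "port_mark N (micro t i) v b \<noteq> Safe" for t i
    using wf_edge[OF wf_micro bv, of t i] wf_hole[OF wf_micro assms(3), of t i]
    by (simp_all add: edge_inv_def port_mark_def)
  have "m \<noteq> Safe"
  proof
    assume "m = Safe"
    have "\<forall>\<^sub>F t in sequentially. False"
      using m[unfolded stable_mark_def]
      by (rule eventually_mono) (use \<open>m = Safe\<close> mark_inv(2) in \<open>auto simp: port_mark_def\<close>)
    then show False by simp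
  qed
  moreover have "\<not> occ (ing v b)"
    unfolding eventually_no_occ using flow_posI[of _ "X _" b v] mark_inv(1)[of _ 0]
    by (intro always_eventually) (metis less_irrefl micro_0)
  then have "m \<noteq> Unexplored"
    using engaged_port[OF assms(1,4,2)] passed_not_unexplored[OF _ assms(2)] m stable_mark_unique by blast
  ultimately show ?thesis using m by (cases m) auto
qed

text \<open>Of the alternatives in \<open>engaged_port\<close>, DANGEROUS is excluded by recurrence,
  agents arriving from \<open>w\<close> must be supplied by its center, and agents leaving for
  \<open>w\<close> arrive there and reach its center.\<close>

lemma engaged_neighbour:
  assumes "engaged v" "{v, w} \<in> edges N" "recurrent N {v, w}" "v \<notin> holes N" "w \<notin> holes N"
  shows "engaged w"
  using engaged_port[OF assms(1,4,2)] recurrent_not_dangerous[OF assms(2-5)]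
    occ_ing_engaged_source[OF _ assms(2-5)] passed_occ[OF _ assms(2)] occ_out_ing[OF _ assms(2,3)]
    occ_ing(2)[OF _ assms(5)] occ_center_engaged by blast

subsection \<open>All safe nodes are engaged\<close>

lemma finite_arcs: "finite {(v, w). {v, w} \<in> edges N}"
proof (rule finite_subset)
  show "{(v, w). {v, w} \<in> edges N} \<subseteq> nodes N \<times> nodes N" using edge_nodes by auto
  show "finite (nodes N \<times> nodes N)" using net by (simp add: network_def)
qed

text \<open>There are finitely many edges, so after some time only recurrent ones are ever present.
  A journey starting later uses recurrent edges only, and with safe endpoints it avoids all black
  holes.\<close>

lemma safe_recurrently_connected:
  assumes "v \<in> safe_nodes N" "w \<in> safe_nodes N"
  shows "(v, w) \<in> {(x, y). {x, y} \<in> edges N \<and> recurrent N {x, y} \<and> x \<in> safe_nodes N \<and> y \<in> safe_nodes N}\<^sup>*"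
    (is "_ \<in> ?R\<^sup>*")
proof -
  have "\<forall>\<^sub>F t in sequentially. recurrent N e \<or> \<not> present N e t" for e
  proof (cases "recurrent N e")
    case False
    then show ?thesis unfolding recurrent_def eventually_sequentially by (meson Suc_le_lessD)
  qed simp
  then have "\<forall>\<^sub>F t in sequentially. \<forall>e\<in>edges N. recurrent N e \<or> \<not> present N e t"
    using finite_edges by (simp add: eventually_ball_finite)
  then obtain T where T: "\<And>t e. t \<ge> T \<Longrightarrow> e \<in> edges N \<Longrightarrow> present N e t \<Longrightarrow> recurrent N e"
    unfolding eventually_sequentially by blast
  obtain vs J where J: "journey N vs J" "hd vs = v" "last vs = w"
      "\<forall>(e, s)\<in>set J. T \<le> s" "set vs \<inter> holes N \<subseteq> {v, w}"
    using tran assms unfolding tran_network_def temporally_connected_def safe_nodes_def by blast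
  have len: "length vs = Suc (length J)" and nodes: "set vs \<subseteq> nodes N"
    and es: "\<And>i. i < length J \<Longrightarrow> fst (J ! i) \<in> edges N \<and> fst (J ! i) = {vs ! i, vs ! Suc i}"
    and pres: "\<And>e t. (e, t) \<in> set J \<Longrightarrow> present N e t"
    using J(1) by (auto simp: journey_def walk_def)
  have safe: "vs ! i \<in> safe_nodes N" if "i \<le> length J" for i
  proof -
    have "vs ! i \<in> set vs" using that len by simp
    then show ?thesis using nodes J(5) assms by (auto simp: safe_nodes_def)
  qed
  have "i \<le> length J \<Longrightarrow> (v, vs ! i) \<in> ?R\<^sup>*" for i
  proof (induction i)
    case 0
    have "vs ! 0 = v" using J(2) len by (metis hd_conv_nth list.size(3) nat.distinct(1))
    then show ?case by simp
  next
    case (Suc i)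
    have "J ! i \<in> set J" using Suc by simp
    then have "T \<le> snd (J ! i)" "present N (fst (J ! i)) (snd (J ! i))"
      using J(4) pres by (auto simp: case_prod_beta)
    moreover have "fst (J ! i) \<in> edges N" using es Suc.prems by (meson Suc_le_lessD)
    ultimately have "recurrent N (fst (J ! i))" using T by blast
    then have "(vs ! i, vs ! Suc i) \<in> ?R" using es[of i] Suc safe[of i] safe[of "Suc i"] by auto
    moreover have "(v, vs ! i) \<in> ?R\<^sup>*" using Suc by simp
    ultimately show ?case by (rule rtrancl_into_rtrancl[rotated])
  qed
  then have "(v, vs ! length J) \<in> ?R\<^sup>*" by blast
  moreover have "vs ! length J = w" using J(3) len by (metis diff_Suc_1 last_conv_nth list.size(3) nat.distinct(1))
  ultimately show ?thesis by simp
qed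

lemma all_engaged:
  assumes "engaged v" "v \<in> safe_nodes N" "w \<in> safe_nodes N"
  shows "engaged w"
  using safe_recurrently_connected[OF assms(2,3)]
proof (induction rule: rtrancl_induct)
  case (step y z)
  then show ?case using engaged_neighbour[of y z] by (auto simp: safe_nodes_def)
qed (rule assms(1))

text \<open>Bounds the agents lost through one edge together with those waiting to cross it. The
  port at \<open>v\<close> cannot be SAFE, and the other two marks fix the flow at 0 or 1.\<close>

lemma flow_into_hole_le:
  assumes "{v, b} \<in> edges N" "b \<in> holes N"
  shows "flow (X t) v b \<le> 1"
proof -
  have bv: "{b, v} \<in> edges N" using assms by (simp add: insert_commute)
  show ?thesis
    using wf_edge[OF wf_X assms(1), of t] wf_edge[OF wf_X bv, of t] wf_hole[OF wf_X assms(2), of t]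
    by (cases "port_mark N (X t) v b") (auto simp: edge_inv_def port_mark_def)
qed

text \<open>This is the factor 2 in the team size: a safe transient edge can hold an agent at either
  end.\<close>

lemma card_arcs_le:
  assumes F: "F \<subseteq> edges N"
  shows "card {(v, w). {v, w} \<in> F} \<le> 2 * card F"
proof -
  define B where "B e = {(v, w). {v, w} = e}" for e :: "'v set"
  have fF: "finite F" using F finite_edges by (rule finite_subset)
  have B: "card (B e) \<le> 2" if "e \<in> F" for e
  proof -
    have "e \<in> edges N" using that F by (rule rev_subsetD)
    then have "card e = 2" using net by (simp add: network_def)
    then obtain x y where e: "e = {x, y}" unfolding card_2_iff by (elim exE conjE)
    have "B e \<subseteq> set [(x, y), (y, x)]" unfolding B_def e by (clarsimp simp: doubleton_eq_iff)
    from card_mono[OF finite_set this] show ?thesis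
      using card_length[of "[(x, y), (y, x)]"] by simp
  qed
  have "{(v, w). {v, w} \<in> F} = (\<Union>e\<in>F. B e)" unfolding B_def by blast
  then have "card {(v, w). {v, w} \<in> F} = card (\<Union>e\<in>F. B e)" by (rule arg_cong)
  also have "\<dots> \<le> (\<Sum>e\<in>F. card (B e))" using fF by (rule card_UN_le)
  also have "\<dots> \<le> (\<Sum>e\<in>F. 2)" using B by (rule sum_mono)
  also have "\<dots> = 2 * card F" by simp
  finally show ?thesis .
qed

lemma some_engaged:
  assumes "card A \<ge> 2 * card {e \<in> edges N. transient N e \<and> \<not> dangerous_edge N e}
                   + (\<Sum>b\<in>holes N. degree N b) + 1"
  shows "\<exists>v\<in>safe_nodes N. engaged v"
proof (rule ccontr)
  assume none: "\<not> ?thesis"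
  let ?F = "{e \<in> edges N. transient N e \<and> \<not> dangerous_edge N e}"
  have "\<not> occ (v, Center)" if "v \<in> safe_nodes N" for v
    using none occ_center_engaged that by blast
  then have e1: "\<forall>\<^sub>F t in sequentially. \<forall>v\<in>safe_nodes N. \<forall>a\<in>A. pos (X t) a \<noteq> (v, Center)"
    unfolding eventually_no_occ by (intro eventually_ball_finite[OF finite_safe] ballI)
  have no_ing: "\<not> occ (v, Ingoing j)" if "v \<in> safe_nodes N" for v j
    using none occ_center_engaged occ_ing(2) that unfolding safe_nodes_def by blast
  have "\<forall>\<^sub>F t in sequentially. \<forall>a\<in>A. v \<in> safe_nodes N \<longrightarrow> pos (X t) a \<noteq> ing v w" for v w
    using no_ing[of v "label N v w"] by (cases "v \<in> safe_nodes N") (simp_all add: eventually_no_occ)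
  then have e2: "\<forall>\<^sub>F t in sequentially. \<forall>(v, w)\<in>{(v, w). {v, w} \<in> edges N}. \<forall>a\<in>A.
      v \<in> safe_nodes N \<longrightarrow> pos (X t) a \<noteq> ing v w"
    unfolding case_prod_beta by (intro eventually_ball_finite[OF finite_arcs[unfolded case_prod_beta]] ballI)
  have "\<forall>\<^sub>F t in sequentially. \<forall>a\<in>A. recurrent N {v, w} \<and> w \<in> safe_nodes N \<longrightarrow> pos (X t) a \<noteq> out v w"
    if "{v, w} \<in> edges N" for v w
    using occ_out_ing[OF _ that] no_ing[of w "label N w v"]
    by (cases "recurrent N {v, w} \<and> w \<in> safe_nodes N") (auto simp: eventually_no_occ[symmetric])
  then have e3: "\<forall>\<^sub>F t in sequentially. \<forall>(v, w)\<in>{(v, w). {v, w} \<in> edges N}. \<forall>a\<in>A.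
      recurrent N {v, w} \<and> w \<in> safe_nodes N \<longrightarrow> pos (X t) a \<noteq> out v w"
    unfolding case_prod_beta by (intro eventually_ball_finite[OF finite_arcs[unfolded case_prod_beta]] ballI) blast
  obtain t where t:
      "\<And>v a. v \<in> safe_nodes N \<Longrightarrow> a \<in> A \<Longrightarrow> pos (X t) a \<noteq> (v, Center)"
      "\<And>v w a. {v, w} \<in> edges N \<Longrightarrow> a \<in> A \<Longrightarrow> v \<in> safe_nodes N \<Longrightarrow> pos (X t) a \<noteq> ing v w"
      "\<And>v w a. {v, w} \<in> edges N \<Longrightarrow> a \<in> A \<Longrightarrow> recurrent N {v, w} \<Longrightarrow> w \<in> safe_nodes N \<Longrightarrow>
        pos (X t) a \<noteq> out v w"
    using eventually_happens'[OF sequentially_bot eventually_conj[OF e1 eventually_conj[OF e2 e3]]] by blast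
  \<comment> \<open>\<open>S\<close> contains both orientations of the safe transient edges.
    \<open>D\<close> contains the pairs leading into a black hole, listed from the side of the hole
    so that the sum of the degrees bounds their number.\<close>
  define S where "S = {(v, w). {v, w} \<in> ?F}"
  define D where "D = prod.swap ` (SIGMA b:holes N. neighbours N b)"
  have S_iff: "(v, w) \<in> S \<longleftrightarrow> {v, w} \<in> edges N \<and> \<not> recurrent N {v, w} \<and> v \<in> safe_nodes N \<and> w \<in> safe_nodes N"
    for v w
    unfolding S_def transient_def dangerous_edge_def safe_edge_def mem_Collect_eq case_prod_conv not_not
      insert_subset by blast
  have D_iff: "(v, w) \<in> D \<longleftrightarrow> {v, w} \<in> edges N \<and> w \<in> holes N" for v w
    unfolding D_def pair_in_swap_image mem_Sigma_iff neighbours_def mem_Collect_eq insert_commute[of w v "{}"]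
    by (rule conj_commute)
  \<comment> \<open>For an edge into a black hole the slot includes the agents already trapped
    behind it, so its size is bounded by \<open>flow\<close>.\<close>
  define slot where "slot = (\<lambda>(v, w). {a \<in> A. pos (X t) a = out v w \<or> w \<in> holes N \<and> pos (X t) a = ing w v})"
  have "\<exists>p\<in>S \<union> D. a \<in> slot p" if a: "a \<in> A" for a
  proof -
    have "placed (X t) a" using wf_placed[OF wf_X a] .
    then consider "\<exists>v\<in>safe_nodes N. pos (X t) a = (v, Center)"
      | v w where "{v, w} \<in> edges N" "pos (X t) a = ing v w"
      | v w where "{v, w} \<in> edges N" "pos (X t) a = out v w"
      unfolding placed_def by blast
    then show ?thesis
    proof cases
      case 1
      then show ?thesis using t(1)[OF _ a] by blast
    next
      case 2
      have "v \<notin> safe_nodes N" using t(2)[OF 2(1) a] 2(2) by blast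
      then have "v \<in> holes N" using edge_nodes[OF 2(1)] by (simp add: safe_nodes_def)
      moreover have "{w, v} \<in> edges N" using 2(1) by (simp add: insert_commute)
      ultimately have "(w, v) \<in> D" "a \<in> slot (w, v)" using 2 a by (simp_all add: slot_def D_iff)
      then show ?thesis by blast
    next
      case 3
      have v: "v \<in> safe_nodes N"
        using wf_out_not_hole[OF wf_X 3(1) a 3(2)] edge_nodes[OF 3(1)] by (simp add: safe_nodes_def)
      have "a \<in> slot (v, w)" using 3 a by (simp add: slot_def)
      moreover have "(v, w) \<in> S \<union> D"
      proof (cases "w \<in> holes N")
        case True
        then show ?thesis using 3 by (simp add: D_iff)
      next
        case False
        then have w: "w \<in> safe_nodes N" using edge_nodes[OF 3(1)] by (simp add: safe_nodes_def)
        then have "\<not> recurrent N {v, w}" using t(3)[OF 3(1) a] 3(2) by blast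
        then show ?thesis using 3 v w by (simp add: S_iff)
      qed
      ultimately show ?thesis by blast
    qed
  qed
  then have cover: "A \<subseteq> (\<Union>p\<in>S \<union> D. slot p)" by blast
  have small: "card (slot p) \<le> 1" if p: "p \<in> S \<union> D" for p
  proof -
    obtain v w where vw: "p = (v, w)" by fastforce
    have edge: "{v, w} \<in> edges N" using p unfolding vw Un_iff S_iff D_iff by (elim disjE conjE)
    show ?thesis
    proof (cases "w \<in> holes N")
      case True
      have slot: "slot p = {a \<in> A. pos (X t) a = out v w} \<union> {a \<in> A. pos (X t) a = ing w v}"
        using True unfolding slot_def vw by auto
      have "card (slot p) \<le> flow (X t) v w"
        unfolding flow_def crowd_at_def slot by (rule card_Un_le)
      also have "\<dots> \<le> 1" using edge True by (rule flow_into_hole_le)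
      finally show ?thesis .
    next
      case False
      then have "card (slot p) = crowd_at A (X t) v (Outgoing (label N v w))"
        unfolding slot_def vw crowd_at_def by simp
      then show ?thesis using wf_edge[OF wf_X edge, of t] unfolding edge_inv_def by linarith
    qed
  qed
  have fS: "finite S" unfolding S_def by (rule finite_subset[OF _ finite_arcs]) blast
  have fH: "finite (holes N)" using net by (meson finite_subset network_def psubset_imp_subset)
  then have fD: "finite D" using finite_neighbours unfolding D_def by (intro finite_imageI finite_SigmaI)
  have "card D \<le> card (SIGMA b:holes N. neighbours N b)"
    using fH finite_neighbours unfolding D_def by (intro card_image_le finite_SigmaI)
  also have "\<dots> = (\<Sum>b\<in>holes N. degree N b)"
    using fH finite_neighbours by (simp add: degree_def)
  finally have card_D: "card D \<le> (\<Sum>b\<in>holes N. degree N b)" .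
  have "card A \<le> card (\<Union>p\<in>S \<union> D. slot p)"
    using cover fS fD fin by (intro card_mono) (auto simp: slot_def)
  also have "\<dots> \<le> (\<Sum>p\<in>S \<union> D. card (slot p))" using fS fD by (intro card_UN_le) simp
  also have "\<dots> \<le> (\<Sum>p\<in>S \<union> D. 1)" using small by (rule sum_mono)
  also have "\<dots> = card (S \<union> D)" by simp
  also have "\<dots> \<le> card S + card D" by (rule card_Un_le)
  also have "\<dots> \<le> 2 * card ?F + (\<Sum>b\<in>holes N. degree N b)"
    using card_D card_arcs_le[of ?F] unfolding S_def by simp
  finally show False using assms by simp
qed

section \<open>Exploration and port marking from engaged nodes\<close>

lemma safe_perpetual_exploration_if_engaged:
  assumes "\<And>v. v \<in> safe_nodes N \<Longrightarrow> engaged v"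
  shows "safe_perpetual_exploration N A X"
  unfolding safe_perpetual_exploration_def
proof (intro ballI allI)
  fix v t assume "v \<in> safe_nodes N"
  then obtain t' a where "t' \<ge> t" "a \<in> set (act t')" "pos (X t') a = (v, Center)"
    using assms unfolding engaged_def frequently_sequentially by blast
  then show "\<exists>t'\<ge>t. visited A (X t') v"
    using act_set unfolding visited_def by (metis fst_conv subsetD)
qed

lemma highly_reliable_port_marking_if_engaged:
  assumes eng: "\<And>v. v \<in> safe_nodes N \<Longrightarrow> engaged v"
  shows "highly_reliable_port_marking N A X"
proof -
  let ?P = "{(v, w). {v, w} \<in> edges N \<and> v \<in> safe_nodes N \<and> (recurrent N {v, w} \<or> dangerous_edge N {v, w})}"
  let ?m = "\<lambda>(v, w). if safe_edge N {v, w} then Safe else Dangerous"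
  have "\<forall>p\<in>?P. \<forall>\<^sub>F t in sequentially. port_mark N (X t) (fst p) (snd p) = ?m p"
  proof
    fix p assume "p \<in> ?P"
    then obtain v w where p: "p = (v, w)" "{v, w} \<in> edges N" "v \<in> safe_nodes N"
      "recurrent N {v, w} \<or> dangerous_edge N {v, w}" by auto
    have "stable_mark v (label N v w) (?m (v, w))"
    proof (cases "safe_edge N {v, w}")
      case True
      then show ?thesis using p engaged_recurrent_mark[OF eng]
        by (auto simp: dangerous_edge_def safe_edge_def safe_nodes_def)
    next
      case False
      then have "w \<in> holes N" using p edge_nodes by (auto simp: safe_edge_def safe_nodes_def)
      then show ?thesis using False p engaged_dangerous_mark[OF eng] by (auto simp: safe_nodes_def)
    qed
    then show "\<forall>\<^sub>F t in sequentially. port_mark N (X t) (fst p) (snd p) = ?m p"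
      unfolding stable_mark_def
      by (rule eventually_mono) (auto simp: p port_mark_def micro_0 dest!: spec[of _ 0])
  qed
  moreover have "finite ?P" by (rule finite_subset[OF _ finite_arcs]) auto
  ultimately have "\<forall>\<^sub>F t in sequentially. \<forall>p\<in>?P. port_mark N (X t) (fst p) (snd p) = ?m p"
    by (intro eventually_ball_finite)
  then obtain T where "\<forall>t\<ge>T. \<forall>p\<in>?P. port_mark N (X t) (fst p) (snd p) = ?m p"
    unfolding eventually_sequentially by blast
  then have T: "port_mark N (X t) v w = (if safe_edge N {v, w} then Safe else Dangerous)"
    if "t \<ge> T" "v \<in> safe_nodes N" "w \<in> neighbours N v" "recurrent N {v, w} \<or> dangerous_edge N {v, w}"
    for t v w
    using that by (fastforce simp: neighbours_def)
  \<comment> \<open>A safe node exists because \<open>holes N\<close> is a proper subset of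
    \<open>nodes N\<close>. An agent at its center after \<open>T\<close> is the required free
    agent.\<close>
  obtain v where v: "v \<in> safe_nodes N" using net by (auto simp: network_def safe_nodes_def)
  then obtain t a where t: "t \<ge> T" "a \<in> set (act t)" "pos (X t) a = (v, Center)"
    using eng unfolding engaged_def frequently_sequentially by blast
  have "\<exists>a\<in>A. free N (X t) a"
    using t v act_set by (auto simp: free_def safe_nodes_def intro!: bexI[of _ a])
  then show ?thesis
    unfolding highly_reliable_port_marking_def using T t(1)
    by (intro exI[of _ t]) (auto simp: dangerous_edge_def)
qed

end

theorem theorem11:
  fixes N :: "'v network" and A :: "'a set" and start :: "'a \<Rightarrow> 'v" and act :: "nat \<Rightarrow> 'a list"
  assumes "tran_network N"
    and "finite A"
    and "card A \<ge> 2 * card {e \<in> edges N. transient N e \<and> \<not> dangerous_edge N e}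
                   + (\<Sum>b\<in>holes N. degree N b) + 1"
    and "\<forall>a\<in>A. start a \<in> safe_nodes N"
    and "ssynch N A act (execution N A start act)"
  shows "safe_perpetual_exploration N A (execution N A start act)
         \<and> highly_reliable_port_marking N A (execution N A start act)"
proof -
  interpret run N A start act using assms by unfold_locales
  have "engaged v" if "v \<in> safe_nodes N" for v
    using some_engaged[OF assms(3)] all_engaged that by blast
  then show ?thesis
    using safe_perpetual_exploration_if_engaged highly_reliable_port_marking_if_engaged by blast
qed

end
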